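(* A set $B$ of monomial symmetric polynomials in the Jucys–Murphy elements, $B\subseteq\{m_\mu(L_1,\dots,L_4):\mu\text{ a partition}\}$, is a $\mathbb Z$-basis of the centre $Z(\mathbb Z S_4)$ if and only if $B$ is one of the following: $\{m_{\emptyset}, m_1, m_2, m_{1,1}, m_{1,1,1}\}$; $\{m_{\emptyset}, m_1, m_{1,1}, m_{1,1,1}, m_{2,2,2}\}$; $\{m_1, m_2, m_{1,1}, m_{1,1,1}, m_{2,2}\}$; $\{m_1, m_{1,1}, m_{1,1,1}, m_{2,2}, m_{2,2,2}\}$; $\{m_{\emptyset}, m_1, m_2, m_{1,1}, m_{3}\}$; $\{m_{\emptyset}, m_1, m_{1,1}, m_{2,2,2}, m_{3}\}$; $\{m_1, m_2, m_{1,1}, m_{3}, m_{2,2}\}$; $\{m_1, m_{1,1}, m_{3}, m_{2,2}, m_{2,2,2}\}$; $\{m_{\emptyset}, m_1, m_{1,1}, m_{1,1,1}, m_{i,i,2}\}$ for some odd $i\ge1$; $\{m_{\emptyset}, m_1, m_{1,1}, m_{3}, m_{i,i,2}\}$ for some odd $i\ge1$.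
   Context: $S_4$ is the symmetric group on $\{1,2,3,4\}$, $\mathbb Z S_4$ its integral group ring, and $Z(\mathbb Z S_4)$ its centre (a free $\mathbb Z$-module of rank 5 with basis the conjugacy class sums). The Jucys–Murphy elements are $L_1=0$ and $L_i=\sum_{k=1}^{i-1}(k\ i)$ for $i=2,3,4$; they pairwise commute, and symmetric polynomials in them are central. For a partition $\mu=(\mu_1,\dots,\mu_r)$, $m_\mu(x_1,\dots,x_4)$ is the monomial symmetric polynomial: the sum of all distinct monomials $x_1^{\alpha_1}\cdots x_4^{\alpha_4}$ with $(\alpha_1,\dots,\alpha_4)$ a rearrangement of $(\mu_1,\dots,\mu_r,0,\dots,0)$ ($m_\mu=0$ if $r>4$; $m_\emptyset=1$). We write $m_\mu$ for $m_\mu(L_1,\dots,L_4)$, omit parentheses in subscripts, and $m_{i,i,2}$ denotes $m_\mu$ with $\mu$ the partition whose parts are $i,i,2$ sorted decreasingly. *)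

theory Defs
  imports "HOL-Combinatorics.Transposition" "HOL-Combinatorics.Permutations" "HOL-Library.Multiset"
begin

definition S4 :: "(nat \<Rightarrow> nat) set" where
  "S4 = {p. p permutes {1..4::nat}}"

definition ZS4 :: "((nat \<Rightarrow> nat) \<Rightarrow> int) set" where
  "ZS4 = {f. \<forall>g. g \<notin> S4 \<longrightarrow> f g = 0}"

definition gmul :: "((nat \<Rightarrow> nat) \<Rightarrow> int) \<Rightarrow> ((nat \<Rightarrow> nat) \<Rightarrow> int) \<Rightarrow> ((nat \<Rightarrow> nat) \<Rightarrow> int)" where
  "gmul a b = (\<lambda>g. if g \<in> S4 then (\<Sum>x\<in>S4. a x * b (inv x \<circ> g)) else 0)"

definition gone :: "(nat \<Rightarrow> nat) \<Rightarrow> int" where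
  "gone = (\<lambda>g. if g = id then 1 else 0)"

primrec gpow :: "((nat \<Rightarrow> nat) \<Rightarrow> int) \<Rightarrow> nat \<Rightarrow> ((nat \<Rightarrow> nat) \<Rightarrow> int)" where
  "gpow a 0 = gone"
| "gpow a (Suc n) = gmul a (gpow a n)"

definition JM :: "nat \<Rightarrow> ((nat \<Rightarrow> nat) \<Rightarrow> int)" where
  "JM i = (\<lambda>g. \<Sum>k\<in>{1..<i}. if g = transpose k i then 1 else 0)"

definition JM_monomial :: "nat list \<Rightarrow> ((nat \<Rightarrow> nat) \<Rightarrow> int)" where
  "JM_monomial \<alpha> = foldr (\<lambda>(i, a) acc. gmul (gpow (JM i) a) acc) (zip [1,2,3,4] \<alpha>) gone"

text \<open>Exponent vectors: the distinct rearrangements of (mu_1,...,mu_r,0,...,0) of length 4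
  (empty if r > 4).\<close>
definition rearrangements :: "nat list \<Rightarrow> nat list set" where
  "rearrangements \<mu> = {\<alpha>. length \<alpha> = 4 \<and> mset \<alpha> = mset \<mu> + replicate_mset (4 - length \<mu>) 0}"

definition msym :: "nat list \<Rightarrow> ((nat \<Rightarrow> nat) \<Rightarrow> int)" where
  "msym \<mu> = (\<lambda>g. \<Sum>\<alpha>\<in>rearrangements \<mu>. JM_monomial \<alpha> g)"

definition is_partition :: "nat list \<Rightarrow> bool" where
  "is_partition \<mu> \<longleftrightarrow> sorted_wrt (\<ge>) \<mu> \<and> 0 \<notin> set \<mu>"

definition centre :: "((nat \<Rightarrow> nat) \<Rightarrow> int) set" where
  "centre = {z \<in> ZS4. \<forall>x\<in>ZS4. gmul z x = gmul x z}"

definition lincomb :: "(((nat \<Rightarrow> nat) \<Rightarrow> int) \<Rightarrow> int) \<Rightarrow> ((nat \<Rightarrow> nat) \<Rightarrow> int) set \<Rightarrow> ((nat \<Rightarrow> nat) \<Rightarrow> int)" where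
  "lincomb c B = (\<lambda>g. \<Sum>b\<in>B. c b * b g)"

definition is_Z_basis_of_centre :: "((nat \<Rightarrow> nat) \<Rightarrow> int) set \<Rightarrow> bool" where
  "is_Z_basis_of_centre B \<longleftrightarrow> finite B \<and> B \<subseteq> centre
     \<and> (\<forall>c. lincomb c B = (\<lambda>_. 0) \<longrightarrow> (\<forall>b\<in>B. c b = 0))
     \<and> (\<forall>z\<in>centre. \<exists>c. z = lincomb c B)"

end

theory Submission
  imports Defs
begin

text \<open>
  Jucys--Murphy elements act on the lines of Young's seminormal basis by contents, so the coefficient
  of a monomial symmetric polynomial at a permutation is an explicit rational combination of
  $a = m_\mu(1,2,3)$, $b = m_\mu(1,2,-1)$ and $c = m_\mu(1,-1,0)$, the values at the contents of the
  shapes (4), (3,1) and (2,2); conjugate shapes contribute the same values up to sign.  In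
  particular $m_\mu$ is supported on even or on odd permutations according to the parity of $|\mu|$,
  and a family is a basis iff it consists of three even and two odd elements
  with determinants $\pm 1$.

  Modulo 2 almost every $m_\mu$ vanishes: the even survivors are $m_{i,i}$ ($i$ odd), $m_{j,j}$
  ($j$ even) and $m_{k,k,2}$, the odd ones $m_1$, $m_{i,i,1}$ and $m_{p,q}$, and a basis
  contains at most one element of each kind.  The determinants are exponential polynomials in
  $i, j, k, p, q$; size estimates and congruences decide when they are $\pm 1$.
\<close>

section \<open>The group ring and its centre\<close>

text \<open>No representation theory is presupposed. Five functions on pairs of points are checked
  by evaluation to be eigenvectors, and the identity is checked, word by word, to be a combination
  of the ten matrix coefficients obtained from them. Multiplying this decomposition by powers of the
  \<open>JM i\<close> only changes scalars, which makes arbitrary exponents accessible. Since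
  \<open>JM 1\<close> is zero, at most three exponents matter.

  The obstacle is an infinite supply of candidates, among which infinite families of bases do occur.
  For odd k the value of m_{k,k,2} at (1,2,-1) is the constant -4, because its powers of 2 cancel;
  its growing value at (1,2,3) drops out of the determinant with m_{i,i} and the unit, because
  m_{i,i} with i odd takes the same value -1 at (1,2,-1) and (1,-1,0).

  A basis enters through its coefficient functionals, which are integral in the class coordinates.
  Reduced modulo 2 they separate its elements, so the number of elements comes out of the parity
  patterns.\<close>

lemma finite_S4 [simp]: "finite S4"
  by (simp add: S4_def finite_permutations)

lemma id_in_S4 [simp]: "id \<in> S4"
  by (simp add: S4_def permutes_id)

lemma comp_in_S4 [simp]: "g \<in> S4 \<Longrightarrow> h \<in> S4 \<Longrightarrow> g \<circ> h \<in> S4"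
  by (simp add: S4_def permutes_compose)

lemma inv_in_S4 [simp]: "g \<in> S4 \<Longrightarrow> inv g \<in> S4"
  by (simp add: S4_def permutes_inv)

lemma S4_inv_o: "g \<in> S4 \<Longrightarrow> inv g \<circ> g = id" "g \<in> S4 \<Longrightarrow> g \<circ> inv g = id"
  by (auto simp: S4_def permutes_inv_o)

lemma S4_bij: "g \<in> S4 \<Longrightarrow> bij g"
  by (simp add: S4_def permutes_bij)

lemma transpose_in_S4 [simp]: "i \<in> {1..4} \<Longrightarrow> k \<in> {1..4} \<Longrightarrow> transpose k i \<in> S4"
  unfolding S4_def by (simp add: permutes_swap_id)

lemma sum_S4_translate:
  assumes "x \<in> S4"
  shows "(\<Sum>y\<in>S4. f (x \<circ> y)) = (\<Sum>y\<in>S4. f y)"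
  by (rule sum.reindex_bij_witness[of _ "\<lambda>y. inv x \<circ> y" "\<lambda>y. x \<circ> y"])
    (use assms in \<open>auto simp: S4_inv_o o_assoc\<close>)

lemma sum_S4_inverse_translate:
  assumes "g \<in> S4"
  shows "(\<Sum>y\<in>S4. f (inv y \<circ> g)) = (\<Sum>y\<in>S4. f y)"
proof (rule sum.reindex_bij_witness[of _ "\<lambda>y. g \<circ> inv y" "\<lambda>y. inv y \<circ> g"])
  fix y assume y: "y \<in> S4"
  show "g \<circ> inv (inv y \<circ> g) = y" and "inv (g \<circ> inv y) \<circ> g = y"
    using y assms S4_bij[of y] S4_bij[of g] S4_inv_o[of g]
    by (simp_all add: o_inv_distrib bij_imp_bij_inv inv_inv_eq o_assoc)
       (simp add: comp_assoc S4_inv_o)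
qed (use assms in auto)

lemma gmul_assoc: "gmul (gmul a b) c = gmul a (gmul b c)"
proof
  fix g
  show "gmul (gmul a b) c g = gmul a (gmul b c) g"
  proof (cases "g \<in> S4")
    case False
    then show ?thesis by (simp add: gmul_def)
  next
    case True
    have "gmul (gmul a b) c g = (\<Sum>x\<in>S4. \<Sum>y\<in>S4. a y * b (inv y \<circ> x) * c (inv x \<circ> g))"
      using True by (simp add: gmul_def sum_distrib_right)
    also have "\<dots> = (\<Sum>y\<in>S4. \<Sum>x\<in>S4. a y * b (inv y \<circ> x) * c (inv x \<circ> g))"
      by (rule sum.swap)
    also have "\<dots> = (\<Sum>y\<in>S4. a y * gmul b c (inv y \<circ> g))"
    proof (rule sum.cong[OF refl])
      fix y assume y: "y \<in> S4"
      have "(\<Sum>x\<in>S4. a y * b (inv y \<circ> x) * c (inv x \<circ> g))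
          = (\<Sum>z\<in>S4. a y * b (inv y \<circ> (y \<circ> z)) * c (inv (y \<circ> z) \<circ> g))"
        using sum_S4_translate[OF y, of "\<lambda>x. a y * b (inv y \<circ> x) * c (inv x \<circ> g)"] by simp
      also have "\<dots> = (\<Sum>z\<in>S4. a y * (b z * c (inv z \<circ> (inv y \<circ> g))))"
        using y by (intro sum.cong)
          (simp_all add: o_assoc S4_inv_o o_inv_distrib S4_bij mult.assoc)
      also have "\<dots> = a y * gmul b c (inv y \<circ> g)"
        using y True by (simp add: gmul_def sum_distrib_left)
      finally show "(\<Sum>x\<in>S4. a y * b (inv y \<circ> x) * c (inv x \<circ> g)) = a y * gmul b c (inv y \<circ> g)" .
    qed
    finally show ?thesis using True by (simp add: gmul_def)
  qed
qed

definition gdelta :: "(nat \<Rightarrow> nat) \<Rightarrow> (nat \<Rightarrow> nat) \<Rightarrow> int" where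
  "gdelta x = (\<lambda>g. if g = x then 1 else 0)"

lemma gdelta_in_ZS4: "x \<in> S4 \<Longrightarrow> gdelta x \<in> ZS4"
  by (auto simp: gdelta_def ZS4_def)

lemma gmul_gdelta_left:
  assumes "x \<in> S4" "g \<in> S4"
  shows "gmul (gdelta x) b g = b (inv x \<circ> g)"
  using assms by (simp add: gmul_def gdelta_def if_distrib[of "\<lambda>c. c * _"] cong: if_cong)

lemma gmul_gdelta_right:
  assumes "x \<in> S4" "g \<in> S4"
  shows "gmul b (gdelta x) (g \<circ> x) = b g"
proof -
  have "inv y \<circ> (g \<circ> x) = x \<longleftrightarrow> y = g" if "y \<in> S4" for y
  proof
    assume "inv y \<circ> (g \<circ> x) = x"
    then have "y \<circ> inv y \<circ> g \<circ> (x \<circ> inv x) = y \<circ> (x \<circ> inv x)"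
      by (metis comp_assoc)
    then show "y = g" using assms that by (simp add: S4_inv_o)
  qed (use assms in \<open>simp add: o_assoc S4_inv_o\<close>)
  then show ?thesis
    using assms by (simp add: gmul_def gdelta_def if_distrib[of "\<lambda>c. _ * c"] cong: if_cong)
qed

lemma gmul_gone_left:
  assumes "f \<in> ZS4"
  shows "gmul gone f = f"
proof
  fix g
  have "gone = gdelta id" by (simp add: gone_def gdelta_def)
  then show "gmul gone f g = f g"
    using assms gmul_gdelta_left[of id g f] by (cases "g \<in> S4") (auto simp: gmul_def ZS4_def)
qed

lemma gmul_JM:
  assumes "i \<in> {1..4}" "g \<in> S4"
  shows "gmul (JM i) f g = (\<Sum>k\<in>{1..<i}. f (transpose k i \<circ> g))"
proof -
  have "gmul (JM i) f g = (\<Sum>x\<in>S4. \<Sum>k\<in>{1..<i}. gdelta (transpose k i) x * f (inv x \<circ> g))"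
    using assms by (simp add: gmul_def JM_def gdelta_def sum_distrib_right)
  also have "\<dots> = (\<Sum>k\<in>{1..<i}. \<Sum>x\<in>S4. gdelta (transpose k i) x * f (inv x \<circ> g))"
    by (rule sum.swap)
  also have "\<dots> = (\<Sum>k\<in>{1..<i}. gmul (gdelta (transpose k i)) f g)"
    using assms by (simp add: gmul_def)
  also have "\<dots> = (\<Sum>k\<in>{1..<i}. f (transpose k i \<circ> g))"
    using assms by (intro sum.cong) (auto simp: gmul_gdelta_left)
  finally show ?thesis .
qed

lemma gmul_sum_right:
  "gmul a (\<lambda>g. \<Sum>t\<in>T. c t * f t g) = (\<lambda>g. \<Sum>t\<in>T. c t * gmul a (f t) g)"
proof
  fix g
  show "gmul a (\<lambda>g. \<Sum>t\<in>T. c t * f t g) g = (\<Sum>t\<in>T. c t * gmul a (f t) g)"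
    by (auto simp: gmul_def sum_distrib_left mult.left_commute intro: sum.swap)
qed

text \<open>Commuting with the single group element x suffices: both products are evaluated at g x =
  x h, where one reads off z at g and the other z at h.\<close>

lemma conjugate_values_of_central:
  assumes "z \<in> centre" "g \<in> S4" "h \<in> S4" "x \<in> S4" "g \<circ> x = x \<circ> h"
  shows "z g = z h"
proof -
  have "gmul z (gdelta x) (g \<circ> x) = gmul (gdelta x) z (g \<circ> x)"
    using assms gdelta_in_ZS4 by (simp add: centre_def)
  moreover have "inv x \<circ> (g \<circ> x) = h"
    using assms by (simp add: o_assoc S4_inv_o)
  ultimately show ?thesis
    using gmul_gdelta_right[of x g z] gmul_gdelta_left[of x "g \<circ> x" z] assms(2,4) by simp
qed

text \<open>The convolution sum is reindexed by x -> x^{-1} g and then translated until it becomes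
  the opposite product. The trace property enters once, to exchange the two factors of (x g)^{-1} g.
  It is assumed in this form because sign and fixed points are compared on the products g h and h
  g.\<close>

lemma class_function_central:
  assumes "z \<in> ZS4" and conj: "\<And>g h. g \<in> S4 \<Longrightarrow> h \<in> S4 \<Longrightarrow> z (g \<circ> h) = z (h \<circ> g)"
  shows "z \<in> centre"
proof -
  have "gmul z b = gmul b z" if "b \<in> ZS4" for b
  proof
    fix g
    show "gmul z b g = gmul b z g"
    proof (cases "g \<in> S4")
      case True
      have "(\<Sum>x\<in>S4. z x * b (inv x \<circ> g)) = (\<Sum>x\<in>S4. z (inv x \<circ> g) * b (inv (inv x \<circ> g) \<circ> g))"
        using sum_S4_inverse_translate[OF True, of "\<lambda>x. z x * b (inv x \<circ> g)"] by simp
      also have "\<dots> = (\<Sum>x\<in>S4. b (inv g \<circ> x \<circ> g) * z (inv x \<circ> g))"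
        using True by (intro sum.cong)
          (simp_all add: o_inv_distrib S4_bij bij_imp_bij_inv inv_inv_eq mult.commute)
      also have "\<dots> = (\<Sum>x\<in>S4. b (inv g \<circ> (g \<circ> x) \<circ> g) * z (inv (g \<circ> x) \<circ> g))"
        using sum_S4_translate[OF True, of "\<lambda>x. b (inv g \<circ> x \<circ> g) * z (inv x \<circ> g)"] by simp
      also have "\<dots> = (\<Sum>x\<in>S4. b (x \<circ> g) * z (inv x))"
      proof (rule sum.cong[OF refl])
        fix x assume "x \<in> S4"
        then have "inv g \<circ> (g \<circ> x) \<circ> g = x \<circ> g" "inv (g \<circ> x) \<circ> g = inv x"
          using True by (simp add: o_assoc S4_inv_o, simp add: o_inv_distrib S4_bij comp_assoc S4_inv_o)
        then show "b (inv g \<circ> (g \<circ> x) \<circ> g) * z (inv (g \<circ> x) \<circ> g) = b (x \<circ> g) * z (inv x)"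
          by simp
      qed
      also have "\<dots> = (\<Sum>x\<in>S4. b x * z (inv x \<circ> g))"
      proof (rule sum.reindex_bij_witness[of _ "\<lambda>x. x \<circ> inv g" "\<lambda>x. x \<circ> g"])
        fix x assume x: "x \<in> S4"
        show "x \<circ> g \<circ> inv g = x" "x \<circ> inv g \<circ> g = x"
          using True by (simp_all add: comp_assoc S4_inv_o)
        show "b (x \<circ> g) * z (inv (x \<circ> g) \<circ> g) = b (x \<circ> g) * z (inv x)"
          using True x conj[of "inv (x \<circ> g)" g]
          by (simp add: o_inv_distrib S4_bij o_assoc S4_inv_o)
      qed (use True in auto)
      finally show ?thesis using True by (simp add: gmul_def)
    qed (simp add: gmul_def)
  qed
  then show ?thesis using assms(1) by (simp add: centre_def)
qed

section \<open>Diagonalising the Jucys--Murphy elements\<close>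

text \<open>One-line notation turns the 24 permutations into an explicit list, over which statements
  can be decided by evaluation.\<close>

definition perm_words :: "nat list list" where
  "perm_words = filter distinct (List.n_lists 4 [1,2,3,4])"

definition word :: "(nat \<Rightarrow> nat) \<Rightarrow> nat list" where
  "word g = [g 1, g 2, g 3, g 4]"

lemma interval_1_4: "{1..4::nat} = {1,2,3,4}"
  by auto

lemma word_in_perm_words:
  assumes "g \<in> S4"
  shows "word g \<in> set perm_words"
proof -
  have p: "g permutes {1..4}" using assms by (simp add: S4_def)
  have "g x \<in> {1,2,3,4}" if "x \<in> {1..4}" for x
    using permutes_in_image[OF p, of x] that interval_1_4 by blast
  moreover have "distinct (word g)"
    using permutes_inj[OF p] by (simp add: word_def inj_eq)
  ultimately show ?thesis
    by (simp add: perm_words_def set_n_lists word_def)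
qed

lemma word_inj:
  assumes "g \<in> S4" "h \<in> S4" "word g = word h"
  shows "g = h"
proof
  fix x
  have p: "g permutes {1..4}" "h permutes {1..4}" using assms by (simp_all add: S4_def)
  show "g x = h x"
  proof (cases "x \<in> {1..4}")
    case True
    then have "x \<in> {1,2,3,4}" by (simp only: interval_1_4)
    then show ?thesis using assms(3) by (auto simp: word_def)
  next
    case False
    then show ?thesis using p[THEN permutes_not_in] by metis
  qed
qed

lemma word_id: "word id = [1,2,3,4]"
  by (simp add: word_def)

text \<open>Functions of an ordered pair of points on which the Jucys--Murphy elements act by scalars:
  they span lines of Young's seminormal basis in the irreducible modules of shape (4), (3,1)
  (three times) and (2,2).  The scalars are the contents of the corresponding standard tableaux;
  twisting by the sign yields the remaining five tableaux.\<close>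

definition seminormal :: "nat \<Rightarrow> nat \<Rightarrow> nat \<Rightarrow> int" where
  "seminormal n x y =
    (if n = 0 then 1
     else if n = 4 then (if x = y then 0 else if x + y = 3 \<or> x + y = 7 then 2 else -1)
     else [[1,-1,0,0],[1,1,-2,0],[1,1,1,-3]] ! (n - 1) ! (x - 1))"

definition content :: "nat \<Rightarrow> nat \<Rightarrow> int" where
  "content n i = [[0,1,2,3],[0,-1,1,2],[0,1,-1,2],[0,1,2,-1],[0,1,-1,0]] ! n ! (i - 1)"

text \<open>Chosen so that 1152 times the identity is the weighted sum of the ten eigenfunctions.\<close>

definition weight :: "nat \<Rightarrow> int" where
  "weight n = [3,18,6,3,4] ! n"

definition word_sign :: "nat list \<Rightarrow> int" where
  "word_sign l = (\<Prod>(i, j)\<leftarrow>[(0,1),(0,2),(0,3),(1,2),(1,3),(2,3)]. if l ! i < l ! j then 1 else -1)"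

text \<open>A diagonal matrix coefficient of the permutation module on ordered pairs: v =
  \<open>seminormal n\<close> is paired with its translate by g. Multiplying g from the left moves
  only the second factor, so the eigenvalues of v carry over. Pairs are used because the shape (2,2)
  does not occur among functions of one point; for n < 4 the second argument is inert and merely
  contributes a factor 4.\<close>

definition word_coeff :: "nat \<Rightarrow> nat list \<Rightarrow> int" where
  "word_coeff n l =
    (\<Sum>x\<leftarrow>[1,2,3,4]. \<Sum>y\<leftarrow>[1,2,3,4]. seminormal n x y * seminormal n (l ! (x - 1)) (l ! (y - 1)))"

definition twist :: "bool \<Rightarrow> int" where
  "twist e = (if e then -1 else 1)"

definition eigenfunction :: "nat \<Rightarrow> bool \<Rightarrow> (nat \<Rightarrow> nat) \<Rightarrow> int" where
  "eigenfunction n e g =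
    (if g \<in> S4 then (if e then word_sign (word g) else 1) * word_coeff n (word g) else 0)"

lemma seminormal_eigenvector:
  "\<forall>n\<in>set [0,1,2,3,4]. \<forall>i\<in>set [1,2,3,4]. \<forall>a\<in>set [1,2,3,4]. \<forall>b\<in>set [1,2,3,4].
    (\<Sum>k\<leftarrow>[1..<i]. seminormal n (transpose k i a) (transpose k i b)) = content n i * seminormal n a b"
  by code_simp

lemma word_sign_transpose:
  "\<forall>l\<in>set perm_words. \<forall>i\<in>set [1,2,3,4]. \<forall>k\<in>set [1..<i].
    word_sign (map (transpose k i) l) = - word_sign l"
  by code_simp

text \<open>This is the decomposition of the regular representation. At the identity the weighted
  coefficients are 48 times the dimension: 48, three times 144, and 96. They add up to 576, and the
  sign twist doubles this to 1152 = 48 * 24.\<close>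

lemma gone_decomposition_words:
  "\<forall>l\<in>set perm_words.
    (\<Sum>n\<leftarrow>[0,1,2,3,4]. weight n * ((1 + word_sign l) * word_coeff n l)) =
    (if l = [1,2,3,4] then 1152 else 0)"
  by code_simp

lemma gone_decomposition_word:
  "g \<in> S4 \<Longrightarrow>
    (\<Sum>n\<le>4. weight n * ((1 + word_sign (word g)) * word_coeff n (word g))) =
    (if g = id then 1152 else 0)"
proof -
  assume g: "g \<in> S4"
  have s: "(\<Sum>n\<leftarrow>[0,1,2,3,4]. f n) = (\<Sum>n\<le>4. f n)" for f :: "nat \<Rightarrow> int"
    by (simp add: numeral_eq_Suc)
  have "word g = [1,2,3,4] \<longleftrightarrow> g = id"
    using word_inj[OF g id_in_S4] word_id by metis
  then show ?thesis
    using gone_decomposition_words[THEN bspec, OF word_in_perm_words[OF g]] unfolding s by simp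
qed

lemma seminormal_JM:
  assumes "n \<le> 4" "i \<in> {1..4}" "a \<in> {1..4}" "b \<in> {1..4}"
  shows "(\<Sum>k\<in>{1..<i}. seminormal n (transpose k i a) (transpose k i b)) = content n i * seminormal n a b"
proof -
  have "n \<in> set [0,1,2,3,4]" "i \<in> set [1,2,3,4]" "a \<in> set [1,2,3,4]" "b \<in> set [1,2,3,4]"
    using assms by auto
  then have "(\<Sum>k\<leftarrow>[1..<i]. seminormal n (transpose k i a) (transpose k i b)) = content n i * seminormal n a b"
    using seminormal_eigenvector by blast
  then show ?thesis
    by (simp add: interv_sum_list_conv_sum_set_nat)
qed

lemma word_coeff_word:
  "word_coeff n (word g) = (\<Sum>x\<in>{1..4}. \<Sum>y\<in>{1..4}. seminormal n x y * seminormal n (g x) (g y))"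
  unfolding interval_1_4 by (simp add: word_coeff_def word_def)

lemma word_coeff_JM:
  assumes "n \<le> 4" "i \<in> {1..4}" "g \<in> S4"
  shows "(\<Sum>k\<in>{1..<i}. word_coeff n (word (transpose k i \<circ> g))) = content n i * word_coeff n (word g)"
proof -
  have g: "g x \<in> {1..4}" if "x \<in> {1..4}" for x
    using assms(3) that permutes_in_image[of g "{1..4}" x] by (simp add: S4_def)
  have "(\<Sum>k\<in>{1..<i}. word_coeff n (word (transpose k i \<circ> g)))
      = (\<Sum>x\<in>{1..4}. \<Sum>y\<in>{1..4}. \<Sum>k\<in>{1..<i}.
          seminormal n x y * seminormal n (transpose k i (g x)) (transpose k i (g y)))"
    unfolding word_coeff_word o_apply
    by (subst sum.swap, rule sum.cong[OF refl], rule sum.swap)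
  also have "\<dots> = (\<Sum>x\<in>{1..4}. \<Sum>y\<in>{1..4}. seminormal n x y * (content n i * seminormal n (g x) (g y)))"
    using assms g by (intro sum.cong refl) (simp only: seminormal_JM sum_distrib_left[symmetric])
  also have "\<dots> = content n i * word_coeff n (word g)"
    by (simp add: word_coeff_word sum_distrib_left mult.left_commute)
  finally show ?thesis .
qed

lemma word_sign_word_transpose:
  assumes "i \<in> {1..4}" "k \<in> {1..<i}" "g \<in> S4"
  shows "word_sign (word (transpose k i \<circ> g)) = - word_sign (word g)"
proof -
  have "word (transpose k i \<circ> g) = map (transpose k i) (word g)"
    by (simp add: word_def)
  moreover have "i \<in> set [1,2,3,4]" "k \<in> set [1..<i]" using assms by auto
  ultimately show ?thesis
    using word_sign_transpose word_in_perm_words[OF assms(3)] by metis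
qed

lemma gmul_scale_right: "gmul a (\<lambda>g. c * f g) = (\<lambda>g. c * gmul a f g)"
  by (auto simp: gmul_def sum_distrib_left mult.left_commute)

lemma eigenfunction_in_ZS4: "eigenfunction n e \<in> ZS4"
  by (simp add: eigenfunction_def ZS4_def)

lemma JM_eigenfunction:
  assumes "n \<le> 4" "i \<in> {1..4}"
  shows "gmul (JM i) (eigenfunction n e) = (\<lambda>g. twist e * content n i * eigenfunction n e g)"
proof
  fix g
  show "gmul (JM i) (eigenfunction n e) g = twist e * content n i * eigenfunction n e g"
  proof (cases "g \<in> S4")
    case False
    then show ?thesis by (simp add: gmul_def eigenfunction_def)
  next
    case True
    have "gmul (JM i) (eigenfunction n e) g = (\<Sum>k\<in>{1..<i}. eigenfunction n e (transpose k i \<circ> g))"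
      using gmul_JM assms(2) True by simp
    also have "\<dots> = (\<Sum>k\<in>{1..<i}. twist e * (if e then word_sign (word g) else 1) *
        word_coeff n (word (transpose k i \<circ> g)))"
    proof (rule sum.cong[OF refl])
      fix k assume "k \<in> {1..<i}"
      then show "eigenfunction n e (transpose k i \<circ> g) = twist e * (if e then word_sign (word g) else 1) *
          word_coeff n (word (transpose k i \<circ> g))"
        using word_sign_word_transpose[of i k g] assms True
        by (simp add: eigenfunction_def twist_def)
    qed
    also have "\<dots> = twist e * content n i * eigenfunction n e g"
      using word_coeff_JM[OF assms True] True
      by (simp add: sum_distrib_left[symmetric] eigenfunction_def mult_ac)
    finally show ?thesis .
  qed
qed

lemma JM_power_eigenfunction:
  assumes "n \<le> 4" "i \<in> {1..4}"
  shows "gmul (gpow (JM i) a) (eigenfunction n e) =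
    (\<lambda>g. (twist e * content n i) ^ a * eigenfunction n e g)"
proof (induction a)
  case 0
  show ?case by (simp add: gmul_gone_left eigenfunction_in_ZS4)
next
  case (Suc a)
  show ?case
    by (simp only: gpow.simps gmul_assoc Suc.IH gmul_scale_right JM_eigenfunction[OF assms])
      (simp add: mult_ac)
qed

lemma JM_power_spectral:
  assumes "i \<in> {1..4}"
  shows "gmul (gpow (JM i) a) (\<lambda>g. \<Sum>(n, e)\<in>{..4} \<times> UNIV. c n e * eigenfunction n e g) =
    (\<lambda>g. \<Sum>(n, e)\<in>{..4} \<times> UNIV. (c n e * (twist e * content n i) ^ a) * eigenfunction n e g)"
  using gmul_sum_right[of "gpow (JM i) a" "\<lambda>(n, e). c n e" "\<lambda>(n, e). eigenfunction n e" "{..4} \<times> UNIV"]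
    JM_power_eigenfunction[OF _ assms]
  by (auto simp: case_prod_beta mult.assoc fun_eq_iff intro!: sum.cong)

lemma gone_spectral:
  "(\<lambda>g. 1152 * gone g) = (\<lambda>g. \<Sum>(n, e)\<in>{..4} \<times> UNIV. weight n * eigenfunction n e g)"
proof
  fix g
  have "(\<Sum>(n, e)\<in>{..4} \<times> UNIV. weight n * eigenfunction n e g)
      = (if g \<in> S4 then \<Sum>n\<le>4. weight n * ((1 + word_sign (word g)) * word_coeff n (word g)) else 0)"
    by (simp add: sum.cartesian_product[symmetric] UNIV_bool eigenfunction_def algebra_simps)
  also have "\<dots> = 1152 * gone g"
    by (auto simp: gone_decomposition_word gone_def)
  finally show "1152 * gone g = (\<Sum>(n, e)\<in>{..4} \<times> UNIV. weight n * eigenfunction n e g)" ..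
qed

lemma JM_monomial_spectral:
  "1152 * JM_monomial [a,b,c,d] g = (\<Sum>(n, e)\<in>{..4} \<times> UNIV.
    weight n * ((twist e * content n 1) ^ a * (twist e * content n 2) ^ b *
      (twist e * content n 3) ^ c * (twist e * content n 4) ^ d) * eigenfunction n e g)"
proof -
  have "(\<lambda>g. 1152 * JM_monomial [a,b,c,d] g) =
    gmul (gpow (JM 1) a) (gmul (gpow (JM 2) b) (gmul (gpow (JM 3) c) (gmul (gpow (JM 4) d) (\<lambda>g. 1152 * gone g))))"
    by (simp add: JM_monomial_def gmul_scale_right)
  also have "\<dots> = (\<lambda>g. \<Sum>(n, e)\<in>{..4} \<times> UNIV.
    (((weight n * (twist e * content n 4) ^ d) * (twist e * content n 3) ^ c) *
      (twist e * content n 2) ^ b) * (twist e * content n 1) ^ a * eigenfunction n e g)"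
    unfolding gone_spectral
    by (simp add: JM_power_spectral JM_power_spectral[of 1, simplified])
  finally show ?thesis
    by (auto simp: fun_eq_iff mult_ac case_prod_beta)
qed

section \<open>Values of monomial symmetric polynomials\<close>

text \<open>The polynomial $m_{p,q,r}(x,y,z)$; correct only for $p \ge q \ge r$.\<close>

definition mono3 :: "nat \<Rightarrow> nat \<Rightarrow> nat \<Rightarrow> int \<Rightarrow> int \<Rightarrow> int \<Rightarrow> int" where
  "mono3 p q r x y z =
    (if p = q \<and> q = r then x ^ p * y ^ p * z ^ p
     else if p = q \<or> q = r then x ^ p * y ^ q * z ^ r + x ^ q * y ^ r * z ^ p + x ^ r * y ^ p * z ^ q
     else x ^ p * y ^ q * z ^ r + x ^ q * y ^ r * z ^ p + x ^ r * y ^ p * z ^ q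
        + x ^ p * y ^ r * z ^ q + x ^ q * y ^ p * z ^ r + x ^ r * y ^ q * z ^ p)"

text \<open>Zeros stand for missing parts, so the triples p \<ge> q \<ge> r index all partitions
  with at most three parts.\<close>

definition elt :: "nat \<Rightarrow> nat \<Rightarrow> nat \<Rightarrow> (nat \<Rightarrow> nat) \<Rightarrow> int" where
  "elt p q r = msym (filter (\<lambda>x. x \<noteq> 0) [p,q,r])"

lemma mono3_swap: "mono3 p q r y x z = mono3 p q r x y z" "mono3 p q r x z y = mono3 p q r x y z"
  by (auto simp: mono3_def algebra_simps)

lemma mono3_scale: "mono3 p q r (t * x) (t * y) (t * z) = t ^ (p + q + r) * mono3 p q r x y z"
  by (auto simp: mono3_def algebra_simps power_mult_distrib power_add)

lemma rearrangements_padded: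
  "rearrangements (filter (\<lambda>x. x \<noteq> 0) [p,q,r]) = {\<alpha>. mset \<alpha> = {#0, p, q, r#}}"
proof -
  have "mset (filter (\<lambda>x. x \<noteq> 0) [p,q,r]) + replicate_mset (4 - length (filter (\<lambda>x. x \<noteq> 0) [p,q,r])) 0
      = {#0, p, q, r#}"
    by (auto simp: numeral_eq_Suc)
  moreover have "length \<alpha> = 4" if "mset \<alpha> = {#0, p, q, r#}" for \<alpha>
    using arg_cong[OF that, of size] by simp
  ultimately show ?thesis
    unfolding rearrangements_def by auto
qed

lemma lists_of_mset3:
  "{\<beta>. mset \<beta> = {#p, q, r#}} = {[p,q,r],[q,r,p],[r,p,q],[p,r,q],[q,p,r],[r,q,p]}"
proof -
  have pair: "b = x \<and> c = y \<or> b = y \<and> c = x" if "{#b, c#} = {#x, y#}" for b c x y :: 'a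
    using that by (auto simp: add_eq_conv_diff)
  have cancel: "M = N" if "add_mset a M = add_mset a N" for a :: 'a and M N
    using that by simp
  have mset3: "mset [a,b,c] = {#a, b, c#}" for a b c :: 'a
    by simp
  have "\<beta> \<in> {[p,q,r],[q,r,p],[r,p,q],[p,r,q],[q,p,r],[r,q,p]}" if m: "mset \<beta> = {#p, q, r#}" for \<beta>
  proof -
    have "length \<beta> = Suc (Suc (Suc 0))"
      using arg_cong[OF m, of size] by simp
    then obtain a b c where \<beta>: "\<beta> = [a,b,c]"
      by (auto simp: length_Suc_conv)
    have "a \<in># {#p, q, r#}" using m[symmetric] \<beta> by simp
    then consider "a = p" | "a = q" | "a = r" by auto
    then show ?thesis
    proof cases
      case 1
      have "add_mset p {#b, c#} = add_mset p {#q, r#}"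
        using m unfolding \<beta> 1 mset3 by (simp only:)
      then have "{#b, c#} = {#q, r#}" by (rule cancel)
      then show ?thesis using pair[of b c q r] by (auto simp: 1 \<beta>)
    next
      case 2
      have "{#p, q, r#} = {#q, p, r#}" by (rule add_mset_commute)
      then have "add_mset q {#b, c#} = add_mset q {#p, r#}"
        using m unfolding \<beta> 2 mset3 by (simp only:)
      then have "{#b, c#} = {#p, r#}" by (rule cancel)
      then show ?thesis using pair[of b c p r] by (auto simp: 2 \<beta>)
    next
      case 3
      have "{#p, q, r#} = {#r, p, q#}" by (metis add_mset_commute)
      then have "add_mset r {#b, c#} = add_mset r {#p, q#}"
        using m unfolding \<beta> 3 mset3 by (simp only:)
      then have "{#b, c#} = {#p, q#}" by (rule cancel)
      then show ?thesis using pair[of b c p q] by (auto simp: 3 \<beta>)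
    qed
  qed
  moreover have "mset \<beta> = {#p, q, r#}"
    if "\<beta> \<in> {[p,q,r],[q,r,p],[r,p,q],[p,r,q],[q,p,r],[r,q,p]}" for \<beta>
    using that by (elim insertE emptyE) (simp_all only: mset3 multiset_eq_iff, simp_all)
  ultimately show ?thesis by (intro set_eqI iffI) (simp_all only: mem_Collect_eq)
qed

text \<open>The first variable is the content 0 of the first box, and 0 ^ 0 = 1: only arrangements
  beginning with 0 contribute, each leaving an arrangement of p, q, r. These number one, three or
  six, which are the branches of \<open>mono3\<close>.\<close>

lemma sum_rearrangements_padded:
  assumes "p \<ge> q" "q \<ge> r"
  shows "(\<Sum>\<alpha>\<in>rearrangements (filter (\<lambda>x. x \<noteq> 0) [p,q,r]).
      0 ^ (\<alpha> ! 0) * x ^ (\<alpha> ! 1) * y ^ (\<alpha> ! 2) * z ^ (\<alpha> ! 3)) = mono3 p q r x y z"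
proof -
  define F :: "nat list \<Rightarrow> int" where
    "F = (\<lambda>\<alpha>. 0 ^ (\<alpha> ! 0) * x ^ (\<alpha> ! 1) * y ^ (\<alpha> ! 2) * z ^ (\<alpha> ! 3))"
  let ?R = "{\<alpha>. mset \<alpha> = {#0, p, q, r#}}"
  let ?T = "{\<beta>. mset \<beta> = {#p, q, r#}}"
  have fin: "finite ?R"
  proof (rule finite_subset)
    show "?R \<subseteq> {\<alpha>. set \<alpha> \<subseteq> {0, p, q, r} \<and> length \<alpha> = 4}"
    proof clarify
      fix \<alpha> assume m: "mset \<alpha> = {#0, p, q, r#}"
      show "set \<alpha> \<subseteq> {0, p, q, r} \<and> length \<alpha> = 4"
        using arg_cong[OF m, of set_mset] arg_cong[OF m, of size] by simp
    qed
  qed (rule finite_lists_length_eq, simp)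
  have "(\<Sum>\<alpha>\<in>?R. F \<alpha>) = (\<Sum>\<alpha>\<in>(#) 0 ` ?T. F \<alpha>)"
  proof (rule sum.mono_neutral_right[OF fin])
    show "(#) 0 ` ?T \<subseteq> ?R" by auto
    show "\<forall>\<alpha>\<in>?R - (#) 0 ` ?T. F \<alpha> = 0"
    proof
      fix \<alpha> assume a: "\<alpha> \<in> ?R - (#) 0 ` ?T"
      then obtain h t where "\<alpha> = h # t" by (cases \<alpha>) auto
      moreover have "h \<noteq> 0" using a calculation by auto
      ultimately show "F \<alpha> = 0" by (simp add: F_def)
    qed
  qed
  also have "\<dots> = (\<Sum>\<beta>\<in>?T. F (0 # \<beta>))"
    by (simp add: sum.reindex)
  also have "\<dots> = mono3 p q r x y z"
    unfolding lists_of_mset3 using assms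
    by (cases "p = q"; cases "q = r") (simp_all add: F_def mono3_def sum.insert_if numeral_3_eq_3)
  finally show ?thesis by (simp only: rearrangements_padded F_def)
qed

lemma content_1: "n \<le> 4 \<Longrightarrow> content n 1 = 0"
proof -
  assume "n \<le> 4"
  then have "n \<in> {0,1,2,3,4}" by auto
  then show ?thesis by (auto simp: content_def)
qed

lemma elt_spectral:
  assumes "p \<ge> q" "q \<ge> r"
  shows "1152 * elt p q r g = (\<Sum>(n, e)\<in>{..4} \<times> UNIV.
    weight n * (twist e ^ (p + q + r) * mono3 p q r (content n 2) (content n 3) (content n 4))
      * eigenfunction n e g)"
proof -
  let ?R = "rearrangements (filter (\<lambda>x. x \<noteq> 0) [p,q,r])"
  let ?M = "\<lambda>n e \<alpha>. (twist e * content n 1) ^ (\<alpha> ! 0) * (twist e * content n 2) ^ (\<alpha> ! 1) *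
      (twist e * content n 3) ^ (\<alpha> ! 2) * (twist e * content n 4) ^ (\<alpha> ! 3)"
  have "1152 * elt p q r g = (\<Sum>\<alpha>\<in>?R. 1152 * JM_monomial \<alpha> g)"
    by (simp only: elt_def msym_def sum_distrib_left)
  also have "\<dots> = (\<Sum>\<alpha>\<in>?R. \<Sum>(n, e)\<in>{..4} \<times> UNIV. weight n * ?M n e \<alpha> * eigenfunction n e g)"
  proof (rule sum.cong[OF refl])
    fix \<alpha> assume "\<alpha> \<in> ?R"
    then have "length \<alpha> = Suc (Suc (Suc (Suc 0)))"
      by (simp add: rearrangements_def)
    then obtain a b c d where "\<alpha> = [a,b,c,d]"
      by (auto simp: length_Suc_conv)
    then show "1152 * JM_monomial \<alpha> g =
        (\<Sum>(n, e)\<in>{..4} \<times> UNIV. weight n * ?M n e \<alpha> * eigenfunction n e g)"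
      by (simp add: JM_monomial_spectral numeral_3_eq_3)
  qed
  also have "\<dots> = (\<Sum>(n, e)\<in>{..4} \<times> UNIV. \<Sum>\<alpha>\<in>?R. weight n * ?M n e \<alpha> * eigenfunction n e g)"
    by (subst sum.swap) (simp add: case_prod_beta)
  also have "\<dots> = (\<Sum>(n, e)\<in>{..4} \<times> UNIV.
    weight n * (twist e ^ (p + q + r) * mono3 p q r (content n 2) (content n 3) (content n 4))
      * eigenfunction n e g)"
  proof (rule sum.cong[OF refl], clarify)
    fix n e assume "n \<le> (4::nat)"
    then have "(\<Sum>\<alpha>\<in>?R. ?M n e \<alpha>) =
        mono3 p q r (twist e * content n 2) (twist e * content n 3) (twist e * content n 4)"
      using sum_rearrangements_padded[OF assms] content_1[of n] by simp
    then show "(\<Sum>\<alpha>\<in>?R. weight n * ?M n e \<alpha> * eigenfunction n e g) =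
      weight n * (twist e ^ (p + q + r) * mono3 p q r (content n 2) (content n 3) (content n 4))
      * eigenfunction n e g"
      by (simp only: mono3_scale sum_distrib_left[symmetric] sum_distrib_right[symmetric])
  qed
  finally show ?thesis .
qed

section \<open>Values on the conjugacy classes\<close>

definition fixed_points :: "nat list \<Rightarrow> int" where
  "fixed_points l = (\<Sum>i\<leftarrow>[0,1,2,3]. if l ! i = Suc i then 1 else 0)"

lemma word_coeff_class_values:
  "\<forall>l\<in>set perm_words. weight 0 * word_coeff 0 l = 48 \<and>
    weight 1 * word_coeff 1 l + weight 2 * word_coeff 2 l + weight 3 * word_coeff 3 l
      = 144 * (fixed_points l - 1) \<and>
    (word_sign l = 1 \<and> weight 4 * word_coeff 4 l = (if fixed_points l = 1 then -48 else 96)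
      \<or> word_sign l = -1)"
  by code_simp

lemma elt_value:
  assumes "p \<ge> q" "q \<ge> r" "g \<in> S4"
  defines "a \<equiv> mono3 p q r 1 2 3" and "b \<equiv> mono3 p q r 1 2 (-1)" and "c \<equiv> mono3 p q r 1 (-1) 0"
    and "f \<equiv> fixed_points (word g)" and "s \<equiv> word_sign (word g)"
  shows "even (p + q + r) \<Longrightarrow> 
      s = 1 \<and> 12 * elt p q r g = a + 3 * (f - 1) * b + (if f = 1 then -c else 2 * c) \<or>
      s = -1 \<and> elt p q r g = 0"
    and "odd (p + q + r) \<Longrightarrow> 
      s = 1 \<and> elt p q r g = 0 \<or> s = -1 \<and> 12 * elt p q r g = a + 3 * (f - 1) * b"
proof -
  let ?w = "\<lambda>n. weight n * word_coeff n (word g)"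
  let ?\<sigma> = "(-1) ^ (p + q + r) :: int"
  \<comment> \<open>The three tableaux of shape (3,1) have the same contents 1, 2, -1 in different
    orders.\<close>
  have b: "mono3 p q r (-1) 1 2 = b" "mono3 p q r 1 (-1) 2 = b"
    unfolding b_def by (metis mono3_swap)+
  have atMost4: "{..4::nat} = {0,1,2,3,4}" by auto
  have "1152 * elt p q r g = (1 + ?\<sigma> * s) *
      (?w 0 * a + ?w 1 * b + ?w 2 * b + ?w 3 * b + ?w 4 * c)"
    unfolding elt_spectral[OF assms(1,2)]
    using b assms(3)
    by (simp add: sum.cartesian_product[symmetric] UNIV_bool eigenfunction_def atMost4 content_def
        twist_def a_def b_def c_def s_def algebra_simps)
  also have "?w 0 * a + ?w 1 * b + ?w 2 * b + ?w 3 * b + ?w 4 * c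
      = ?w 0 * a + (?w 1 + ?w 2 + ?w 3) * b + ?w 4 * c"
    by (simp add: algebra_simps)
  finally have *: "1152 * elt p q r g = (1 + ?\<sigma> * s) * (?w 0 * a + (?w 1 + ?w 2 + ?w 3) * b + ?w 4 * c)" .
  have w: "?w 0 = 48" "?w 1 + ?w 2 + ?w 3 = 144 * (f - 1)"
    "s = 1 \<and> ?w 4 = (if f = 1 then -48 else 96) \<or> s = -1"
    using word_coeff_class_values[THEN bspec, OF word_in_perm_words[OF assms(3)]]
    unfolding f_def s_def by blast+
  \<comment> \<open>Negation permutes the contents 1, -1, 0, as the shape (2,2) is self-conjugate.
    In odd degree this forces c = 0.\<close>
  have c: "?\<sigma> * c = c"
    using mono3_scale[of p q r "-1" 1 "-1" 0] mono3_swap(1)[of p q r "-1" 1 0] unfolding c_def by simp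
  show "s = 1 \<and> 12 * elt p q r g = a + 3 * (f - 1) * b + (if f = 1 then -c else 2 * c) \<or>
      s = -1 \<and> elt p q r g = 0" if "even (p + q + r)"
  proof -
    have "?\<sigma> = 1" using that by (metis uminus_power_if power_one)
    then have e: "1152 * elt p q r g = (1 + s) * (48 * a + 144 * (f - 1) * b + ?w 4 * c)"
      using * unfolding w(1,2) by (simp only: mult_1)
    from w(3) show ?thesis
    proof
      assume h: "s = 1 \<and> ?w 4 = (if f = 1 then -48 else 96)"
      then have "1152 * elt p q r g = 2 * (48 * a + 144 * ((f - 1) * b) + (if f = 1 then -48 else 96) * c)"
        using e by (simp only: mult.assoc one_add_one)
      then show ?thesis using h by (simp only: mult.assoc) (simp split: if_splits)
    next
      assume "s = -1"
      then show ?thesis using e by simp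
    qed
  qed
  show "s = 1 \<and> elt p q r g = 0 \<or> s = -1 \<and> 12 * elt p q r g = a + 3 * (f - 1) * b" if "odd (p + q + r)"
  proof -
    have \<sigma>: "?\<sigma> = -1" using that by (metis uminus_power_if power_one)
    then have "c = 0" using c by simp
    with \<sigma> have e: "1152 * elt p q r g = (1 - s) * (48 * a + 144 * ((f - 1) * b))"
      using * unfolding w(1,2) by (simp only: mult_zero_right) simp
    from w(3) show ?thesis
    proof
      assume "s = 1 \<and> ?w 4 = (if f = 1 then -48 else 96)"
      then show ?thesis using e by simp
    next
      assume "s = -1"
      then show ?thesis using e by (simp only: mult.assoc) simp
    qed
  qed
qed

section \<open>Class coordinates and bases\<close>

text \<open>Representatives of the classes of cycle type 1, 22, 3, 2 and 4, in this order.\<close>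

definition rep :: "nat \<Rightarrow> nat \<Rightarrow> nat" where
  "rep t = [id, transpose 1 2 \<circ> transpose 3 4, transpose 1 2 \<circ> transpose 2 3, transpose 1 2,
    transpose 1 2 \<circ> transpose 2 3 \<circ> transpose 3 4] ! t"

definition class_index :: "nat list \<Rightarrow> nat" where
  "class_index l =
    (if word_sign l = 1 then (if fixed_points l = 4 then 0 else if fixed_points l = 0 then 1 else 2)
     else if fixed_points l = 2 then 3 else 4)"

definition word_comp :: "nat list \<Rightarrow> nat list \<Rightarrow> nat list" where
  "word_comp l m = map (\<lambda>i. l ! (i - 1)) m"

lemma less_5: "t < 5 \<longleftrightarrow> t \<in> {0,1,2,3,4::nat}"
  by auto

lemma sum_less_5: "(\<Sum>t<5::nat. f t) = f 0 + f 1 + f 2 + f 3 + (f 4 :: int)"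
  by (simp add: numeral_eq_Suc)

lemma rep_in_S4 [simp]: "t < 5 \<Longrightarrow> rep t \<in> S4"
  unfolding less_5 by (auto simp: rep_def)

lemma rep_word:
  "t < 5 \<Longrightarrow> word (rep t) = [[1,2,3,4],[2,1,4,3],[2,3,1,4],[2,1,3,4],[2,3,4,1]] ! t"
  unfolding less_5 by (auto simp: rep_def word_def)

text \<open>By counting: the 24 permutations have distinct words, and there are 24 words.\<close>

lemma word_surj:
  assumes "l \<in> set perm_words"
  shows "\<exists>g\<in>S4. word g = l"
proof -
  have "card (word ` S4) = card S4"
    using word_inj by (intro card_image inj_onI)
  also have "\<dots> = 24"
    unfolding S4_def by (subst card_permutations[of _ 4]) (simp_all add: fact_numeral)
  also have "\<dots> = length perm_words"
    by code_simp
  finally have "card (set perm_words) \<le> card (word ` S4)"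
    using card_length[of perm_words] by simp
  then have "word ` S4 = set perm_words"
    using word_in_perm_words by (intro card_seteq) auto
  then show ?thesis using assms by (metis imageE)
qed

lemma word_comp:
  assumes "h \<in> S4"
  shows "word (g \<circ> h) = word_comp (word g) (word h)"
proof -
  have "word g ! (h x - 1) = g (h x)" if "x \<in> {1..4}" for x
  proof -
    have "h x \<in> {1..4}"
      using assms that permutes_in_image[of h "{1..4}" x] by (simp add: S4_def)
    then have "h x \<in> {1,2,3,4}" by (simp only: interval_1_4)
    then show ?thesis by (auto simp: word_def)
  qed
  from this[of 1] this[of 2] this[of 3] this[of 4] show ?thesis
    by (simp add: word_comp_def word_def[of h] word_def[of "g \<circ> h"])
qed

lemma words_conjugate_to_reps:
  "\<forall>l\<in>set perm_words. \<exists>m\<in>set perm_words.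
    word_comp l m = word_comp m ([[1,2,3,4],[2,1,4,3],[2,3,1,4],[2,1,3,4],[2,3,4,1]] ! class_index l)"
  by code_simp

lemma word_comp_class:
  "\<forall>l\<in>set perm_words. \<forall>m\<in>set perm_words.
    word_sign (word_comp l m) = word_sign (word_comp m l) \<and>
    fixed_points (word_comp l m) = fixed_points (word_comp m l)"
  by code_simp

lemma class_index_rep_words:
  "\<forall>t\<in>set [0,1,2,3,4].
    class_index ([[1,2,3,4],[2,1,4,3],[2,3,1,4],[2,1,3,4],[2,3,4,1]] ! t) = t"
  by code_simp

lemma class_index_less: "class_index l < 5"
  by (simp add: class_index_def)

lemma class_index_rep: "t < 5 \<Longrightarrow> class_index (word (rep t)) = t"
  using class_index_rep_words rep_word[of t] unfolding less_5 by auto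

lemma class_invariants_commute:
  assumes "g \<in> S4" "h \<in> S4"
  shows "word_sign (word (g \<circ> h)) = word_sign (word (h \<circ> g))"
    and "fixed_points (word (g \<circ> h)) = fixed_points (word (h \<circ> g))"
  using word_comp_class word_in_perm_words assms by (simp_all add: word_comp)

lemma central_value:
  assumes "z \<in> centre" "g \<in> S4"
  shows "z g = z (rep (class_index (word g)))"
proof -
  define t where "t = class_index (word g)"
  have t: "t < 5" by (simp add: t_def class_index_less)
  obtain m where m: "m \<in> set perm_words" "word_comp (word g) m = word_comp m (word (rep t))"
    using words_conjugate_to_reps word_in_perm_words[OF assms(2)] t unfolding t_def
    by (metis rep_word)
  obtain x where x: "x \<in> S4" "word x = m" using word_surj m(1) by blast
  have "word (g \<circ> x) = word (x \<circ> rep t)"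
    using m x t by (simp add: word_comp)
  then have "g \<circ> x = x \<circ> rep t"
    using assms x t by (intro word_inj) auto
  then show ?thesis
    using conjugate_values_of_central[OF assms rep_in_S4[OF t] x(1)] by (simp only: t_def)
qed

lemma central_outside: "z \<in> centre \<Longrightarrow> g \<notin> S4 \<Longrightarrow> z g = 0"
  by (simp add: centre_def ZS4_def)

definition class_sum :: "nat \<Rightarrow> (nat \<Rightarrow> nat) \<Rightarrow> int" where
  "class_sum t = (\<lambda>g. if g \<in> S4 \<and> class_index (word g) = t then 1 else 0)"

lemma class_sum_central: "class_sum t \<in> centre"
  by (rule class_function_central)
    (auto simp: class_sum_def ZS4_def class_index_def class_invariants_commute)

lemma class_sum_rep: "s < 5 \<Longrightarrow> class_sum t (rep s) = (if s = t then 1 else 0)"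
  by (simp add: class_sum_def class_index_rep)

lemma class_sum_expansion:
  assumes "z \<in> centre"
  shows "z g = (\<Sum>t<5. z (rep t) * class_sum t g)"
proof (cases "g \<in> S4")
  case True
  have "(\<Sum>t<5. z (rep t) * class_sum t g) = (\<Sum>t<5. if t = class_index (word g) then z (rep t) else 0)"
    using True by (intro sum.cong) (auto simp: class_sum_def)
  also have "\<dots> = z (rep (class_index (word g)))"
    by (simp add: class_index_less)
  finally show ?thesis using central_value[OF assms True] by simp
qed (simp add: central_outside[OF assms] class_sum_def)

text \<open>The coefficient of b0 is a linear function on the centre, hence determined by the class
  sums: d t is the coefficient of b0 in the t-th class sum. This works without knowing beforehand
  how many elements B has.\<close>

lemma basis_dual_functional:
  assumes B: "is_Z_basis_of_centre B" and "b0 \<in> B"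
  shows "\<exists>d :: nat \<Rightarrow> int. \<forall>b\<in>B. (\<Sum>t<5. d t * b (rep t)) = (if b = b0 then 1 else 0)"
proof -
  have "\<forall>t. \<exists>c. class_sum t = lincomb c B"
    using B class_sum_central by (simp add: is_Z_basis_of_centre_def)
  then obtain c where c: "\<And>t. class_sum t = lincomb (c t) B" by metis
  have fin: "finite B" and sub: "B \<subseteq> centre" using B by (auto simp: is_Z_basis_of_centre_def)
  have "(\<Sum>t<5. c t b0 * b (rep t)) = (if b = b0 then 1 else 0)" if b: "b \<in> B" for b
  proof -
    \<comment> \<open>Expanding b in class sums, and those in B, gives a second expression of b
      through B. The differences of the coefficients form the relation e, and its vanishing at b0 is
      the claim.\<close>
    define e where "e = (\<lambda>b'. (\<Sum>t<5. c t b' * b (rep t)) - (if b = b' then 1 else 0))"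
    have "lincomb e B = (\<lambda>_. 0)"
    proof
      fix g
      have "b g = (\<Sum>t<5. b (rep t) * (\<Sum>b'\<in>B. c t b' * b' g))"
        using class_sum_expansion[of b g] b sub c by (auto simp: lincomb_def)
      also have "\<dots> = (\<Sum>t<5. \<Sum>b'\<in>B. c t b' * b (rep t) * b' g)"
        by (simp add: sum_distrib_left mult_ac)
      also have "\<dots> = (\<Sum>b'\<in>B. \<Sum>t<5. c t b' * b (rep t) * b' g)"
        by (rule sum.swap)
      finally have 1: "(\<Sum>b'\<in>B. (\<Sum>t<5. c t b' * b (rep t)) * b' g) = b g"
        by (simp add: sum_distrib_right)
      have 2: "(\<Sum>b'\<in>B. (if b = b' then 1 else 0) * b' g) = b g"
        using b fin by (simp add: if_distrib[of "\<lambda>x. x * _"] cong: if_cong)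
      show "lincomb e B g = 0"
        using 1 2 by (simp add: lincomb_def e_def left_diff_distrib sum_subtractf)
    qed
    then have "e b0 = 0"
      using B assms(2) by (auto simp: is_Z_basis_of_centre_def)
    then show ?thesis by (simp add: e_def)
  qed
  then show ?thesis by (intro exI[of _ "\<lambda>t. c t b0"]) simp
qed

text \<open>Every class sum is an integral combination of B, so the functional d is even on it; its
  value on the s-th class sum is d s.\<close>

lemma basis_even_functional:
  assumes B: "is_Z_basis_of_centre B" and ev: "\<forall>b\<in>B. even (\<Sum>t<5. d t * b (rep t))" and "s < 5"
  shows "even (d s :: int)"
proof -
  obtain c where c: "class_sum s = lincomb c B"
    using B class_sum_central unfolding is_Z_basis_of_centre_def by metis
  have "d s = (\<Sum>t<5. if t = s then d t else 0)"
    using assms(3) by simp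
  also have "\<dots> = (\<Sum>t<5. d t * class_sum s (rep t))"
    by (intro sum.cong) (auto simp: class_sum_rep)
  also have "\<dots> = (\<Sum>t<5. \<Sum>b\<in>B. c b * (d t * b (rep t)))"
    by (simp add: c lincomb_def sum_distrib_left mult_ac)
  also have "\<dots> = (\<Sum>b\<in>B. c b * (\<Sum>t<5. d t * b (rep t)))"
    by (subst sum.swap) (simp add: sum_distrib_left)
  also have "even \<dots>"
    using ev by (intro dvd_sum) auto
  finally show ?thesis .
qed

section \<open>Determinants of the even and the odd block\<close>

definition det3 :: "((nat \<Rightarrow> nat) \<Rightarrow> int) \<Rightarrow> ((nat \<Rightarrow> nat) \<Rightarrow> int) \<Rightarrow> ((nat \<Rightarrow> nat) \<Rightarrow> int) \<Rightarrow> int" where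
  "det3 u v w =
    u (rep 0) * (v (rep 1) * w (rep 2) - v (rep 2) * w (rep 1))
    - u (rep 1) * (v (rep 0) * w (rep 2) - v (rep 2) * w (rep 0))
    + u (rep 2) * (v (rep 0) * w (rep 1) - v (rep 1) * w (rep 0))"

definition det2 :: "((nat \<Rightarrow> nat) \<Rightarrow> int) \<Rightarrow> ((nat \<Rightarrow> nat) \<Rightarrow> int) \<Rightarrow> int" where
  "det2 x y = x (rep 3) * y (rep 4) - x (rep 4) * y (rep 3)"

definition even_supported :: "((nat \<Rightarrow> nat) \<Rightarrow> int) \<Rightarrow> bool" where
  "even_supported u \<longleftrightarrow> u \<in> centre \<and> u (rep 3) = 0 \<and> u (rep 4) = 0"

definition odd_supported :: "((nat \<Rightarrow> nat) \<Rightarrow> int) \<Rightarrow> bool" where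
  "odd_supported u \<longleftrightarrow> u \<in> centre \<and> u (rep 0) = 0 \<and> u (rep 1) = 0 \<and> u (rep 2) = 0"

lemma cramer3:
  "det3 u v w * z (rep 0) = det3 z v w * u (rep 0) + det3 u z w * v (rep 0) + det3 u v z * w (rep 0)"
  "det3 u v w * z (rep 1) = det3 z v w * u (rep 1) + det3 u z w * v (rep 1) + det3 u v z * w (rep 1)"
  "det3 u v w * z (rep 2) = det3 z v w * u (rep 2) + det3 u z w * v (rep 2) + det3 u v z * w (rep 2)"
  by (simp_all add: det3_def algebra_simps)

lemma cramer2:
  "det2 x y * z (rep 3) = det2 z y * x (rep 3) + det2 x z * y (rep 3)"
  "det2 x y * z (rep 4) = det2 z y * x (rep 4) + det2 x z * y (rep 4)"
  by (simp_all add: det2_def algebra_simps)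

lemma det3_lincomb:
  "det3 (\<lambda>g. a * u g + b * v g + c * w g) v w = a * det3 u v w"
  "det3 u (\<lambda>g. a * u g + b * v g + c * w g) w = b * det3 u v w"
  "det3 u v (\<lambda>g. a * u g + b * v g + c * w g) = c * det3 u v w"
  by (simp_all add: det3_def algebra_simps)

lemma det2_lincomb:
  "det2 (\<lambda>g. a * x g + b * y g) y = a * det2 x y"
  "det2 x (\<lambda>g. a * x g + b * y g) = b * det2 x y"
  by (simp_all add: det2_def algebra_simps)

lemma lincomb_5:
  assumes "distinct [u, v, w, x, y]"
  shows "lincomb c {u, v, w, x, y} = (\<lambda>g. c u * u g + c v * v g + c w * w g + c x * x g + c y * y g)"
  using assms by (simp add: lincomb_def fun_eq_iff)

text \<open>The coordinate matrix is block diagonal. Independence comes from replacing one column by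
  the vanishing combination, spanning from Cramer's rule.\<close>

lemma basis_of_dets:
  assumes e: "even_supported u" "even_supported v" "even_supported w"
    and o: "odd_supported x" "odd_supported y"
    and d3: "\<bar>det3 u v w\<bar> = 1" and d2: "\<bar>det2 x y\<bar> = 1"
  shows "is_Z_basis_of_centre {u, v, w, x, y}"
proof -
  have d: "det3 u v w * det3 u v w = 1" "det2 x y * det2 x y = 1"
    using d3 d2 by (auto simp: abs_if split: if_splits)
  have "det3 u u w = 0" "det3 u v u = 0" "det3 u v v = 0" "det2 x x = 0"
    by (simp_all add: det3_def det2_def algebra_simps)
  then have "u \<noteq> v" "u \<noteq> w" "v \<noteq> w" "x \<noteq> y"
    using d3 d2 by auto
  moreover have "\<not> odd_supported u" "\<not> odd_supported v" "\<not> odd_supported w"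
    using d3 by (auto simp: det3_def odd_supported_def)
  ultimately have dist: "distinct [u, v, w, x, y]"
    using o by (simp only: distinct.simps list.set insert_iff empty_iff) metis
  have sub: "{u, v, w, x, y} \<subseteq> centre"
    using e o by (simp add: even_supported_def odd_supported_def)
  have cen: "u \<in> centre" "v \<in> centre" "w \<in> centre" "x \<in> centre" "y \<in> centre"
    using sub by simp_all
  note z = e[unfolded even_supported_def] o[unfolded odd_supported_def]
  have indep: "c b = 0" if l: "lincomb c {u, v, w, x, y} = (\<lambda>_. 0)" and b: "b \<in> {u, v, w, x, y}" for c b
  proof -
    have l': "c u * u g + c v * v g + c w * w g + c x * x g + c y * y g = 0" for g
      using fun_cong[OF l, of g] by (simp add: lincomb_5[OF dist])
    have eqs: "c u * u (rep 0) + c v * v (rep 0) + c w * w (rep 0) = 0"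
      "c u * u (rep 1) + c v * v (rep 1) + c w * w (rep 1) = 0"
      "c u * u (rep 2) + c v * v (rep 2) + c w * w (rep 2) = 0"
      "c x * x (rep 3) + c y * y (rep 3) = 0"
      "c x * x (rep 4) + c y * y (rep 4) = 0"
      using l'[of "rep 0"] l'[of "rep 1"] l'[of "rep 2"] l'[of "rep 3"] l'[of "rep 4"] z by simp_all
    have "det3 (\<lambda>g. c u * u g + c v * v g + c w * w g) v w = 0"
      "det3 u (\<lambda>g. c u * u g + c v * v g + c w * w g) w = 0"
      "det3 u v (\<lambda>g. c u * u g + c v * v g + c w * w g) = 0"
      "det2 (\<lambda>g. c x * x g + c y * y g) y = 0" "det2 x (\<lambda>g. c x * x g + c y * y g) = 0"
      by (simp_all only: det3_def det2_def eqs) simp_all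
    then have "c u * det3 u v w = 0" "c v * det3 u v w = 0" "c w * det3 u v w = 0"
      "c x * det2 x y = 0" "c y * det2 x y = 0"
      by (simp_all only: det3_lincomb det2_lincomb)
    moreover have "det3 u v w \<noteq> 0" "det2 x y \<noteq> 0" using d3 d2 by auto
    ultimately have "c u = 0" "c v = 0" "c w = 0" "c x = 0" "c y = 0" by simp_all
    then show ?thesis using b by (elim insertE emptyE) simp_all
  qed
  have span: "\<exists>c. z = lincomb c {u, v, w, x, y}" if zc: "z \<in> centre" for z
  proof -
    \<comment> \<open>Cramer's rule divides by the determinant; a determinant \<plusminus>1 is its
      own inverse, so multiplication replaces the division.\<close>
    define c where "c = (\<lambda>b. if b = u then det3 u v w * det3 z v w
      else if b = v then det3 u v w * det3 u z w else if b = w then det3 u v w * det3 u v z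
      else if b = x then det2 x y * det2 z y else det2 x y * det2 x z)"
    have c: "c u = det3 u v w * det3 z v w" "c v = det3 u v w * det3 u z w" "c w = det3 u v w * det3 u v z"
      "c x = det2 x y * det2 z y" "c y = det2 x y * det2 x z"
      using dist by (auto simp: c_def)
    define L where "L = lincomb c {u, v, w, x, y}"
    have L: "L g = c u * u g + c v * v g + c w * w g + c x * x g + c y * y g" for g
      by (simp add: L_def lincomb_5[OF dist])
    have "L (rep 0) = (det3 u v w * det3 u v w) * z (rep 0)"
      "L (rep 1) = (det3 u v w * det3 u v w) * z (rep 1)"
      "L (rep 2) = (det3 u v w * det3 u v w) * z (rep 2)"
      "L (rep 3) = (det2 x y * det2 x y) * z (rep 3)"
      "L (rep 4) = (det2 x y * det2 x y) * z (rep 4)"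
      unfolding L c mult.assoc cramer3[of u v w z] cramer2[of x y z]
      using z by (simp_all add: distrib_left)
    then have r: "L (rep t) = z (rep t)" if "t < 5" for t
      using that unfolding less_5 d by (elim insertE emptyE) simp_all
    have "z g = L g" for g
    proof (cases "g \<in> S4")
      case True
      have "L g = L (rep (class_index (word g)))"
        unfolding L using cen[THEN central_value, OF True] by (simp only:)
      then show ?thesis
        using central_value[OF zc True] r[OF class_index_less] by simp
    next
      case False
      then show ?thesis
        unfolding L using cen[THEN central_outside, OF False] central_outside[OF zc False] by simp
    qed
    then have "z = L" by (rule ext)
    then show ?thesis unfolding L_def by (intro exI[of _ c])
  qed
  show ?thesis
    unfolding is_Z_basis_of_centre_def
    by (intro conjI allI impI ballI sub indep span) (simp_all only: finite.insertI finite.emptyI)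
qed

lemma elt_central:
  assumes "p \<ge> q" "q \<ge> r"
  shows "elt p q r \<in> centre"
proof (rule class_function_central)
  have "1152 * elt p q r g = 0" if "g \<notin> S4" for g
    unfolding elt_spectral[OF assms] using that
    by (intro sum.neutral) (auto simp: eigenfunction_def)
  then show "elt p q r \<in> ZS4" by (auto simp: ZS4_def)
next
  fix g h assume gh: "g \<in> S4" "h \<in> S4"
  note inv = class_invariants_commute[OF gh]
  have "12 * elt p q r (g \<circ> h) = 12 * elt p q r (h \<circ> g)"
    using elt_value[OF assms comp_in_S4[OF gh]] elt_value[OF assms comp_in_S4[OF gh(2,1)]]
    unfolding inv by (cases "even (p + q + r)") auto
  then show "elt p q r (g \<circ> h) = elt p q r (h \<circ> g)" by simp
qed

lemma rep_invariants:
  "\<forall>t\<in>set [0,1,2,3,4].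
    word_sign ([[1,2,3,4],[2,1,4,3],[2,3,1,4],[2,1,3,4],[2,3,4,1]] ! t) = [1,1,1,-1,-1] ! t \<and>
    fixed_points ([[1,2,3,4],[2,1,4,3],[2,3,1,4],[2,1,3,4],[2,3,4,1]] ! t) = [4,0,1,2,0] ! t"
  by code_simp

lemma elt_even_coordinates:
  assumes "p \<ge> q" "q \<ge> r" "even (p + q + r)"
  shows "even_supported (elt p q r)"
    and "12 * elt p q r (rep 0) = mono3 p q r 1 2 3 + 9 * mono3 p q r 1 2 (-1) + 2 * mono3 p q r 1 (-1) 0"
    and "12 * elt p q r (rep 1) = mono3 p q r 1 2 3 - 3 * mono3 p q r 1 2 (-1) + 2 * mono3 p q r 1 (-1) 0"
    and "12 * elt p q r (rep 2) = mono3 p q r 1 2 3 - mono3 p q r 1 (-1) 0"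
  using elt_value(1)[OF assms(1,2) rep_in_S4 assms(3), of 0] elt_value(1)[OF assms(1,2) rep_in_S4 assms(3), of 1]
    elt_value(1)[OF assms(1,2) rep_in_S4 assms(3), of 2] elt_value(1)[OF assms(1,2) rep_in_S4 assms(3), of 3]
    elt_value(1)[OF assms(1,2) rep_in_S4 assms(3), of 4] rep_invariants
  by (auto simp: rep_word even_supported_def elt_central[OF assms(1,2)])

lemma elt_odd_coordinates:
  assumes "p \<ge> q" "q \<ge> r" "odd (p + q + r)"
  shows "odd_supported (elt p q r)"
    and "12 * elt p q r (rep 3) = mono3 p q r 1 2 3 + 3 * mono3 p q r 1 2 (-1)"
    and "12 * elt p q r (rep 4) = mono3 p q r 1 2 3 - 3 * mono3 p q r 1 2 (-1)"
  using elt_value(2)[OF assms(1,2) rep_in_S4 assms(3), of 0] elt_value(2)[OF assms(1,2) rep_in_S4 assms(3), of 1]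
    elt_value(2)[OF assms(1,2) rep_in_S4 assms(3), of 2] elt_value(2)[OF assms(1,2) rep_in_S4 assms(3), of 3]
    elt_value(2)[OF assms(1,2) rep_in_S4 assms(3), of 4] rep_invariants
  by (auto simp: rep_word odd_supported_def elt_central[OF assms(1,2)])

text \<open>Four parts force a positive exponent on \<open>JM 1\<close>, which is zero; for more
  than four parts there is no arrangement of length 4.\<close>

lemma msym_long:
  assumes "is_partition \<mu>" "length \<mu> \<ge> 4"
  shows "msym \<mu> = (\<lambda>_. 0)"
proof
  fix g
  show "msym \<mu> g = 0"
    unfolding msym_def
  proof (rule sum.neutral, rule ballI)
    fix \<alpha> assume "\<alpha> \<in> rearrangements \<mu>"
    then have l: "length \<alpha> = 4" and m: "mset \<alpha> = mset \<mu>"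
      using assms(2) by (auto simp: rearrangements_def)
    from l obtain a b c d where \<alpha>: "\<alpha> = [a,b,c,d]"
      by (auto simp: length_Suc_conv numeral_eq_Suc)
    have "a \<in> set \<mu>" using mset_eq_setD[OF m] \<alpha> by auto
    then have "a > 0" using assms(1) unfolding is_partition_def by (metis gr0I)
    then have "1152 * JM_monomial \<alpha> g = 0"
      unfolding \<alpha> JM_monomial_spectral
      by (intro sum.neutral) (auto simp: content_1[simplified])
    then show "JM_monomial \<alpha> g = 0" by simp
  qed
qed

lemma msym_cases:
  assumes "is_partition \<mu>"
  obtains "msym \<mu> = (\<lambda>_. 0)" | p q r where "p \<ge> q" "q \<ge> r" "msym \<mu> = elt p q r"
proof (cases "length \<mu> \<ge> 4")
  case True
  then show ?thesis using msym_long[OF assms] that(1) by blast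
next
  case False
  then consider "\<mu> = []" | a where "\<mu> = [a]" | a b where "\<mu> = [a, b]" | a b c where "\<mu> = [a, b, c]"
    by (cases \<mu> rule: remdups_adj.cases; cases "tl (tl \<mu>)"; cases "tl (tl (tl \<mu>))") auto
  then show ?thesis
  proof cases
    case 1 then show ?thesis using that(2)[of 0 0 0] by (simp add: elt_def)
  next
    case (2 a) then show ?thesis using that(2)[of 0 a 0] assms by (simp add: elt_def is_partition_def)
  next
    case (3 a b) then show ?thesis using that(2)[of b a 0] assms by (simp add: elt_def is_partition_def)
  next
    case (4 a b c) then show ?thesis using that(2)[of b a c] assms by (simp add: elt_def is_partition_def)
  qed
qed

section \<open>Coordinates modulo 2\<close>

text \<open>Here k is the number of distinct arrangements, fixed by the true exponents. It is a
  separate argument because reducing exponents modulo the period can make distinct ones equal, which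
  would select the wrong branch of \<open>mono3\<close>.\<close>

definition orbit :: "nat \<Rightarrow> nat \<Rightarrow> nat \<Rightarrow> nat \<Rightarrow> int \<Rightarrow> int \<Rightarrow> int \<Rightarrow> int" where
  "orbit k p q r x y z =
    (if k = 1 then x ^ p * y ^ q * z ^ r
     else if k = 3 then x ^ p * y ^ q * z ^ r + x ^ q * y ^ r * z ^ p + x ^ r * y ^ p * z ^ q
     else x ^ p * y ^ q * z ^ r + x ^ q * y ^ r * z ^ p + x ^ r * y ^ p * z ^ q
        + x ^ p * y ^ r * z ^ q + x ^ q * y ^ p * z ^ r + x ^ r * y ^ q * z ^ p)"

text \<open>Twelve times a class coordinate is an integral combination of a, b, c, so the coordinate
  is odd exactly when this combination is 12 modulo 24.\<close>

definition orbit_parity :: "nat \<Rightarrow> nat \<Rightarrow> nat \<Rightarrow> nat \<Rightarrow> bool list" where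
  "orbit_parity k p q r =
    (let a = orbit k p q r 1 2 3; b = orbit k p q r 1 2 (-1); c = orbit k p q r 1 (-1) 0 in
     if even (p + q + r)
     then [(a + 9 * b + 2 * c) mod 24 = 12, (a - 3 * b + 2 * c) mod 24 = 12, (a - c) mod 24 = 12, False, False]
     else [False, False, False, (a + 3 * b) mod 24 = 12, (a - 3 * b) mod 24 = 12])"

text \<open>Modulo 24 the powers of -1, 0, 1, 2, 3 depend only on this reduced exponent.\<close>

definition reduced_exponent :: "nat \<Rightarrow> nat" where
  "reduced_exponent n = (if n \<le> 4 then n else if odd n then 3 else 4)"

definition parity_vec :: "((nat \<Rightarrow> nat) \<Rightarrow> int) \<Rightarrow> bool list" where
  "parity_vec b = map (\<lambda>t. odd (b (rep t))) [0,1,2,3,4]"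

lemma power_mod_24_step:
  "x \<in> {-1, 0, 1, 2, 3} \<Longrightarrow> n \<ge> 3 \<Longrightarrow> x ^ (n + 2) mod 24 = x ^ n mod (24::int)"
proof -
  assume x: "x \<in> {-1, 0, 1, 2, 3}" and n: "n \<ge> 3"
  obtain m where m: "n = m + 3" using n by (metis add.commute le_Suc_ex)
  have "x ^ 5 mod 24 = x ^ 3 mod 24" using x by auto
  then have "x ^ m * x ^ 5 mod 24 = x ^ m * x ^ 3 mod 24" by (intro mod_mult_cong refl)
  then show ?thesis by (simp add: m power_add[symmetric] add.commute)
qed

lemma power_mod_24_reduced:
  assumes "x \<in> {-1, 0, 1, 2, 3}"
  shows "x ^ n mod 24 = x ^ reduced_exponent n mod (24::int)"
proof (induction n rule: less_induct)
  case (less n)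
  show ?case
  proof (cases "n \<le> 4")
    case False
    then have "reduced_exponent (n - 2) = reduced_exponent n"
      by (cases "n = 5"; cases "n = 6") (auto simp: reduced_exponent_def)
    moreover have "n - 2 \<ge> 3" "n - 2 + 2 = n" using False by auto
    then have "x ^ n mod 24 = x ^ (n - 2) mod 24"
      using power_mod_24_step[OF assms, of "n - 2"] by metis
    ultimately show ?thesis using less[of "n - 2"] False by simp
  qed (simp add: reduced_exponent_def)
qed

lemma orbit_mod_24:
  assumes "x \<in> {-1, 0, 1, 2, 3}" "y \<in> {-1, 0, 1, 2, 3}" "z \<in> {-1, 0, 1, 2, 3}"
  shows "orbit k p q r x y z mod 24 =
    orbit k (reduced_exponent p) (reduced_exponent q) (reduced_exponent r) x y z mod 24"
proof -
  have if_mod: "(if b then u else v) mod 24 = (if b then u' else v') mod 24"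
    if "u mod 24 = u' mod 24" "v mod 24 = v' mod 24" for b and u v u' v' :: int
    using that by simp
  show ?thesis
    unfolding orbit_def
    by (intro if_mod mod_add_cong mod_mult_cong power_mod_24_reduced assms)
qed

lemma even_reduced_exponent: "even (reduced_exponent n) = even n"
  by (simp add: reduced_exponent_def)

lemma orbit_parity_reduced:
  "orbit_parity k p q r =
    orbit_parity k (reduced_exponent p) (reduced_exponent q) (reduced_exponent r)"
proof -
  let ?p = "reduced_exponent p" and ?q = "reduced_exponent q" and ?r = "reduced_exponent r"
  let ?a = "orbit k p q r 1 2 3" and ?b = "orbit k p q r 1 2 (-1)" and ?c = "orbit k p q r 1 (-1) 0"
  let ?a' = "orbit k ?p ?q ?r 1 2 3" and ?b' = "orbit k ?p ?q ?r 1 2 (-1)" and ?c' = "orbit k ?p ?q ?r 1 (-1) 0"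
  have m: "?a mod 24 = ?a' mod 24" "?b mod 24 = ?b' mod 24" "?c mod 24 = ?c' mod 24"
    by (intro orbit_mod_24; simp)+
  have "(?a + 9 * ?b + 2 * ?c) mod 24 = (?a' + 9 * ?b' + 2 * ?c') mod 24"
    "(?a - 3 * ?b + 2 * ?c) mod 24 = (?a' - 3 * ?b' + 2 * ?c') mod 24"
    "(?a - ?c) mod 24 = (?a' - ?c') mod 24"
    "(?a + 3 * ?b) mod 24 = (?a' + 3 * ?b') mod 24"
    "(?a - 3 * ?b) mod 24 = (?a' - 3 * ?b') mod 24"
    by (intro mod_add_cong mod_diff_cong mod_mult_cong m refl)+
  moreover have "even (p + q + r) = even (?p + ?q + ?r)"
    by (simp add: even_reduced_exponent)
  ultimately show ?thesis
    unfolding orbit_parity_def Let_def by (simp only:)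
qed

text \<open>What remains of p > q after reduction: exponents from 3 on collapse to 3 or 4, so their
  order may be lost or even reversed, as for 5 > 4.\<close>

definition above :: "nat \<Rightarrow> nat \<Rightarrow> bool" where
  "above p q \<longleftrightarrow> p > q \<or> p \<ge> 3 \<and> q \<ge> 3"

lemma above_reduced: "p > q \<Longrightarrow> above (reduced_exponent p) (reduced_exponent q)"
  by (auto simp: above_def reduced_exponent_def)

lemma orbit_parity_6:
  "\<forall>p\<in>set [0,1,2,3,4]. \<forall>q\<in>set [0,1,2,3,4]. \<forall>r\<in>set [0,1,2,3,4]. above p q \<longrightarrow> above q r \<longrightarrow>
    orbit_parity 6 p q r =
      (if even (p + q + r) \<or> r \<noteq> 0 then [False, False, False, False, False]
       else [False, False, False, True, True])"
  by code_simp

lemma orbit_parity_3_equal_first: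
  "\<forall>p\<in>set [0,1,2,3,4]. \<forall>r\<in>set [0,1,2,3,4]. above p r \<longrightarrow>
    orbit_parity 3 p p r =
      (if r = 0 then (if odd p then [False, True, True, False, False] else [True, False, False, False, False])
       else if r = 1 then [False, False, False, False, True]
       else if r = 2 then [False, False, True, False, False]
       else [False, False, False, False, False])"
  by code_simp

lemma orbit_parity_3_equal_last:
  "\<forall>p\<in>set [0,1,2,3,4]. \<forall>r\<in>set [0,1,2,3,4]. above p r \<longrightarrow>
    orbit_parity 3 p r r =
      (if p = 2 then [False, False, True, False, False]
       else if p = 1 then [False, False, False, True, False]
       else if odd p \<and> r = 0 then [False, False, False, True, True]
       else [False, False, False, False, False])"
  by code_simp

lemma orbit_parity_1:
  "\<forall>p\<in>set [0,1,2,3,4].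
    orbit_parity 1 p p p =
      (if p = 0 then [True, False, False, False, False]
       else if p = 1 then [False, False, False, False, True]
       else if p = 2 then [False, False, True, False, False]
       else [False, False, False, False, False])"
  by code_simp

lemma reduced_exponent_range: "reduced_exponent p \<in> set [0,1,2,3,4]"
  by (auto simp: reduced_exponent_def)

lemma reduced_exponent_eq: "k \<le> 2 \<Longrightarrow> reduced_exponent p = k \<longleftrightarrow> p = k"
  by (auto simp: reduced_exponent_def)

lemma odd_iff_mod_24: "12 * e = (v::int) \<Longrightarrow> odd e \<longleftrightarrow> v mod 24 = 12"
  by presburger

lemma parity_vec_elt:
  assumes "p \<ge> q" "q \<ge> r"
  shows "parity_vec (elt p q r) =
    orbit_parity (if p = q \<and> q = r then 1 else if p = q \<or> q = r then 3 else 6) p q r"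
proof -
  let ?k = "if p = q \<and> q = r then 1 else if p = q \<or> q = r then 3 else 6 :: nat"
  have m: "mono3 p q r = orbit ?k p q r"
    by (simp add: fun_eq_iff mono3_def orbit_def)
  show ?thesis
  proof (cases "even (p + q + r)")
    case True
    note E = elt_even_coordinates[OF assms True, unfolded m]
    have "orbit_parity ?k p q r = [odd (elt p q r (rep 0)), odd (elt p q r (rep 1)), odd (elt p q r (rep 2)), False, False]"
      unfolding orbit_parity_def Let_def E(2-4)[THEN odd_iff_mod_24] using True by (simp only: if_True)
    then show ?thesis
      using E(1) by (simp add: parity_vec_def even_supported_def del: One_nat_def)
  next
    case False
    note E = elt_odd_coordinates[OF assms False, unfolded m]
    have "orbit_parity ?k p q r = [False, False, False, odd (elt p q r (rep 3)), odd (elt p q r (rep 4))]"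
      unfolding orbit_parity_def Let_def E(2-3)[THEN odd_iff_mod_24] using False by (simp only: if_False)
    then show ?thesis
      using E(1) by (simp add: parity_vec_def odd_supported_def del: One_nat_def)
  qed
qed

text \<open>The partition with parts k, k, 2 must be written in decreasing order, hence the two
  branches. With k = 0 the family contains m_2, with k = 2 it contains m_{2,2,2}.\<close>

definition elt_kk2 :: "nat \<Rightarrow> (nat \<Rightarrow> nat) \<Rightarrow> int" where
  "elt_kk2 k = (if k \<le> 2 then elt 2 k k else elt k k 2)"

text \<open>The equalities among p, q, r determine the orbit size, and the evaluated tables give the
  parities. The tables single out only the exponents 0, 1, 2 and parities; both are preserved by
  reduction, so the result names true exponents.\<close>

lemma elt_cases:
  assumes "p \<ge> q" "q \<ge> r"
  obtains
    (null) "parity_vec (elt p q r) = [False, False, False, False, False]"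
  | (ii) i where "odd i" "elt p q r = elt i i 0" "parity_vec (elt p q r) = [False, True, True, False, False]"
  | (jj) j where "even j" "elt p q r = elt j j 0" "parity_vec (elt p q r) = [True, False, False, False, False]"
  | (kk2) k where "elt p q r = elt_kk2 k" "parity_vec (elt p q r) = [False, False, True, False, False]"
  | (one) "elt p q r = elt 1 0 0" "parity_vec (elt p q r) = [False, False, False, True, False]"
  | (ii1) i where "i \<ge> 1" "elt p q r = elt i i 1" "parity_vec (elt p q r) = [False, False, False, False, True]"
  | (pq) a b where "a > b" "a \<ge> 2" "odd (a + b)" "elt p q r = elt a b 0"
      "parity_vec (elt p q r) = [False, False, False, True, True]"
proof -
  let ?p = "reduced_exponent p" and ?q = "reduced_exponent q" and ?r = "reduced_exponent r"
  note R = reduced_exponent_range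
  note par = parity_vec_elt[OF assms, unfolded orbit_parity_reduced[of _ p q r]]
  consider "p = q" "q = r" | "p = q" "q > r" | "p > q" "q = r" | "p > q" "q > r"
    using assms by linarith
  then show thesis
  proof cases
    case 1
    then have v: "parity_vec (elt p q r) =
      (if p = 0 then [True, False, False, False, False]
       else if p = 1 then [False, False, False, False, True]
       else if p = 2 then [False, False, True, False, False]
       else [False, False, False, False, False])"
      using par orbit_parity_1[THEN bspec, OF R[of p]] by (simp add: reduced_exponent_eq)
    show ?thesis
      using 1 v jj[of 0] ii1[of 1] kk2[of 2] null by (auto simp: elt_kk2_def split: if_splits)
  next
    case 2
    then have v: "parity_vec (elt p q r) =
      (if r = 0 then (if odd p then [False, True, True, False, False] else [True, False, False, False, False])
       else if r = 1 then [False, False, False, False, True]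
       else if r = 2 then [False, False, True, False, False]
       else [False, False, False, False, False])"
      using par orbit_parity_3_equal_first[THEN bspec, OF R[of p], THEN bspec, OF R[of r]]
        above_reduced[of r q] by (simp add: reduced_exponent_eq even_reduced_exponent)
    show ?thesis
      using 2 v ii[of p] jj[of p] ii1[of p] kk2[of p] null by (auto simp: elt_kk2_def split: if_splits)
  next
    case 3
    then have v: "parity_vec (elt p q r) =
      (if p = 2 then [False, False, True, False, False]
       else if p = 1 then [False, False, False, True, False]
       else if odd p \<and> r = 0 then [False, False, False, True, True]
       else [False, False, False, False, False])"
      using par orbit_parity_3_equal_last[THEN bspec, OF R[of p], THEN bspec, OF R[of r]]
        above_reduced[of q p] by (simp add: reduced_exponent_eq even_reduced_exponent)
    show ?thesis
      using 3 v kk2[of r] one pq[of 0 p] null by (auto simp: elt_kk2_def split: if_splits)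
  next
    case 4
    then have v: "parity_vec (elt p q r) =
      (if even (p + q + r) \<or> r \<noteq> 0 then [False, False, False, False, False]
       else [False, False, False, True, True])"
      using par orbit_parity_6[THEN bspec, OF R[of p], THEN bspec, OF R[of q], THEN bspec, OF R[of r]]
        above_reduced[of q p] above_reduced[of r q] by (simp add: reduced_exponent_eq even_reduced_exponent)
    show ?thesis
      using 4 v pq[of q p] null by (auto split: if_splits)
  qed
qed

section \<open>Determinants\<close>

text \<open>The coefficients are the central characters |C| chi(C) / chi(1) of the shapes (4),
  (3,1), (2,2) on the even classes, of sizes 1, 3, 8.\<close>

lemma even_values_of_coordinates:
  assumes "p \<ge> q" "q \<ge> r" "even (p + q + r)"
  defines "u \<equiv> elt p q r"
  shows "mono3 p q r 1 2 3 = u (rep 0) + 3 * u (rep 1) + 8 * u (rep 2)"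
    and "mono3 p q r 1 2 (-1) = u (rep 0) - u (rep 1)"
    and "mono3 p q r 1 (-1) 0 = u (rep 0) + 3 * u (rep 1) - 4 * u (rep 2)"
  using elt_even_coordinates(2-4)[OF assms(1-3)] unfolding u_def by linarith+

text \<open>The matrix of central characters with rows (1,3,8), (1,-1,0), (1,3,-4) has determinant
  48.\<close>

lemma det3_elt:
  assumes "p \<ge> q" "q \<ge> r" "even (p + q + r)" "p' \<ge> q'" "q' \<ge> r'" "even (p' + q' + r')"
    "p'' \<ge> q''" "q'' \<ge> r''" "even (p'' + q'' + r'')"
  shows "48 * det3 (elt p q r) (elt p' q' r') (elt p'' q'' r'') =
      mono3 p q r 1 2 3 * (mono3 p' q' r' 1 2 (-1) * mono3 p'' q'' r'' 1 (-1) 0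
        - mono3 p' q' r' 1 (-1) 0 * mono3 p'' q'' r'' 1 2 (-1))
    - mono3 p q r 1 2 (-1) * (mono3 p' q' r' 1 2 3 * mono3 p'' q'' r'' 1 (-1) 0
        - mono3 p' q' r' 1 (-1) 0 * mono3 p'' q'' r'' 1 2 3)
    + mono3 p q r 1 (-1) 0 * (mono3 p' q' r' 1 2 3 * mono3 p'' q'' r'' 1 2 (-1)
        - mono3 p' q' r' 1 2 (-1) * mono3 p'' q'' r'' 1 2 3)"
  unfolding even_values_of_coordinates[OF assms(1-3)] even_values_of_coordinates[OF assms(4-6)]
    even_values_of_coordinates[OF assms(7-9)] det3_def
  by (simp add: algebra_simps)

lemma odd_values_of_coordinates:
  assumes "p \<ge> q" "q \<ge> r" "odd (p + q + r)"
  defines "u \<equiv> elt p q r"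
  shows "mono3 p q r 1 2 3 = 6 * u (rep 3) + 6 * u (rep 4)"
    and "mono3 p q r 1 2 (-1) = 2 * u (rep 3) - 2 * u (rep 4)"
  using elt_odd_coordinates(2-3)[OF assms(1-3)] unfolding u_def by linarith+

text \<open>On the odd classes the rows are (6,6), (2,-2), of determinant -24; the sign is absorbed
  in the order of the two products.\<close>

lemma det2_elt:
  assumes "p \<ge> q" "q \<ge> r" "odd (p + q + r)" "p' \<ge> q'" "q' \<ge> r'" "odd (p' + q' + r')"
  shows "24 * det2 (elt p q r) (elt p' q' r') =
    mono3 p' q' r' 1 2 3 * mono3 p q r 1 2 (-1) - mono3 p q r 1 2 3 * mono3 p' q' r' 1 2 (-1)"
  unfolding odd_values_of_coordinates[OF assms(1-3)] odd_values_of_coordinates[OF assms(4-6)] det2_def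
  by (simp add: algebra_simps)

section \<open>Exponential equations excluded by congruences\<close>

lemma power_mod_periodic:
  fixes x m :: int
  assumes "x ^ (s + T) mod m = x ^ s mod m" "n \<ge> s"
  shows "x ^ n mod m = x ^ (s + (n - s) mod T) mod m"
proof -
  have step: "x ^ (s + k + T * l) mod m = x ^ (s + k) mod m" for k l
  proof (induction l)
    case (Suc l)
    have "x ^ (s + k + T * Suc l) = x ^ (s + T) * x ^ (k + T * l)"
      by (simp add: power_add[symmetric] algebra_simps)
    also have "\<dots> mod m = x ^ s * x ^ (k + T * l) mod m"
      using assms(1) by (intro mod_mult_cong refl)
    also have "x ^ s * x ^ (k + T * l) = x ^ (s + k + T * l)"
      by (simp add: power_add algebra_simps)
    finally show ?case using Suc by simp
  qed simp
  have "n = s + (n - s) mod T + T * ((n - s) div T)"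
    using assms(2) by (simp add: algebra_simps)
  then show ?thesis using step by metis
qed

text \<open>The values of $m_{n,n}$ and $m_{k,k,2}$ at $(1,2,3)$, for exponents where these have three terms.\<close>

definition value_nn :: "nat \<Rightarrow> int" where
  "value_nn n = 2 ^ n + 3 ^ n + 6 ^ n"

definition value_kk2 :: "nat \<Rightarrow> int" where
  "value_kk2 k = 6 ^ k + 4 * 3 ^ k + 9 * 2 ^ k"

lemma not_in_residues:
  "v mod m \<noteq> c mod m \<Longrightarrow> v mod m \<noteq> (- c) mod m \<Longrightarrow> c \<ge> 0 \<Longrightarrow> \<bar>v\<bar> \<noteq> (c::int)"
  by (auto simp: abs_if split: if_splits)

text \<open>From exponent 4 (respectively 2, 2, 0) on, powers of 2, 3 and 6 are periodic modulo 7280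
  (respectively 9, 4095, 5), with period 12 (respectively 6, 12, 4).\<close>

lemma residues_7280:
  "\<forall>i\<in>set [3,5,7,9,11,13,15]. \<forall>j\<in>set [4,6,8,10,12,14].
    (value_nn i + value_nn j - 2 ^ j * (7 + value_nn i)) mod 7280 \<noteq> 12 \<and>
    (value_nn i + value_nn j - 2 ^ j * (7 + value_nn i)) mod 7280 \<noteq> 7268"
  by code_simp

lemma residues_9:
  "\<forall>i\<in>set [1,3,5,7]. \<forall>j\<in>set [2,4,6]. \<forall>k\<in>set [2,4,6].
    (value_kk2 k * (2 * 2 ^ j) - (2 * 2 ^ k + 4) * (value_nn i + value_nn j)) mod 9 \<noteq> 3 \<and>
    (value_kk2 k * (2 * 2 ^ j) - (2 * 2 ^ k + 4) * (value_nn i + value_nn j)) mod 9 \<noteq> 6"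
  by code_simp

lemma residues_4095:
  "\<forall>i\<in>set [2,4,6,8,10,12]. \<forall>p\<in>set [3,5,7,9,11,13].
    ((6 ^ i + 2 * 3 ^ i + 3 * 2 ^ i) * 2 ^ p - (1 + 2 ^ p + 3 ^ p) * 2) mod 4095 \<noteq> (24::int) \<and>
    ((6 ^ i + 2 * 3 ^ i + 3 * 2 ^ i) * 2 ^ p - (1 + 2 ^ p + 3 ^ p) * 2) mod 4095 \<noteq> (4071::int)"
  by code_simp

lemma residues_5:
  "\<forall>i\<in>set [0,2]. \<forall>p\<in>set [0,1,2,3]. \<forall>q\<in>set [0,1,2,3]. odd (p + q) \<longrightarrow>
    ((6 ^ i + 2 * 3 ^ i + 3 * 2 ^ i) * (2 ^ p + 2 ^ q + 2 ^ p * (-1) ^ q + 2 ^ q * (-1) ^ p)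
      - (2 ^ p + 2 ^ q + 3 ^ p + 3 ^ q + 2 ^ p * 3 ^ q + 3 ^ p * 2 ^ q) * 2) mod 5 \<noteq> (4::int) \<and>
    ((6 ^ i + 2 * 3 ^ i + 3 * 2 ^ i) * (2 ^ p + 2 ^ q + 2 ^ p * (-1) ^ q + 2 ^ q * (-1) ^ p)
      - (2 ^ p + 2 ^ q + 3 ^ p + 3 ^ q + 2 ^ p * 3 ^ q + 3 ^ p * 2 ^ q) * 2) mod 5 \<noteq> (1::int)"
  by code_simp

lemma odd_less_12: "odd r \<Longrightarrow> r < 12 \<Longrightarrow> r \<in> set [1,3,5,7,9,11::nat]"
  by simp presburger

lemma even_less_12: "even r \<Longrightarrow> r < 12 \<Longrightarrow> r \<in> set [0,2,4,6,8,10::nat]"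
  by simp presburger

lemma odd_less_6: "odd r \<Longrightarrow> r < 6 \<Longrightarrow> r \<in> set [1,3,5::nat]"
  by simp presburger

lemma even_less_6: "even r \<Longrightarrow> r < 6 \<Longrightarrow> r \<in> set [0,2,4::nat]"
  by simp presburger

text \<open>The case k = 0 of \<open>det3_unit_pos\<close>, where either of 6^j and 2^j 6^i can be
  the larger term. The modulus is 16 * 5 * 7 * 13: Fermat gives period 12 modulo 5, 7 and 13; modulo
  16 the powers of 2 and 6 vanish from exponent 4 on and those of 3 have period 4.\<close>

lemma no_solution_7280:
  assumes "odd i" "i \<ge> 3" "even j" "j \<ge> 4"
  shows "\<bar>value_nn i + value_nn j - 2 ^ j * (7 + value_nn i)\<bar> \<noteq> 12"
proof -
  \<comment> \<open>The exponent 3 lies below the onset 4 of the period and stands for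
    itself.\<close>
  define i' where "i' = (if i = 3 then 3 else 4 + (i - 4) mod 12)"
  define j' where "j' = 4 + (j - 4) mod 12"
  have p: "x ^ n mod 7280 = x ^ (4 + (n - 4) mod 12) mod 7280"
    if "x \<in> {2, 3, 6}" "n \<ge> 4" for x :: int and n
    using that by (intro power_mod_periodic) auto
  have i: "x ^ i mod 7280 = x ^ i' mod 7280" if "x \<in> {2, 3, 6}" for x :: int
    using p[OF that, of i] assms by (auto simp: i'_def)
  have j: "x ^ j mod 7280 = x ^ j' mod 7280" if "x \<in> {2, 3, 6}" for x :: int
    using p[OF that, of j] assms by (auto simp: j'_def)
  have "(value_nn i + value_nn j - 2 ^ j * (7 + value_nn i)) mod 7280 = (value_nn i' + value_nn j' - 2 ^ j' * (7 + value_nn i')) mod 7280"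
    unfolding value_nn_def by (intro mod_add_cong mod_diff_cong mod_mult_cong i j refl) simp_all
  moreover have "i' \<in> set [3,5,7,9,11,13,15]"
  proof (cases "i = 3")
    case False
    then have "odd (i - 4)" using assms by auto
    then have "(i - 4) mod 12 \<in> set [1,3,5,7,9,11]"
      by (intro odd_less_12) (simp_all add: dvd_mod_iff)
    then show ?thesis unfolding i'_def using False by auto
  qed (simp add: i'_def)
  moreover have "j' \<in> set [4,6,8,10,12,14]"
  proof -
    have "(j - 4) mod 12 \<in> set [0,2,4,6,8,10]"
      using assms by (intro even_less_12) (simp_all add: dvd_mod_iff)
    then show ?thesis unfolding j'_def by auto
  qed
  ultimately show ?thesis
    using residues_7280[THEN bspec, of i', THEN bspec, of j']
    by (intro not_in_residues[of _ 7280]) simp_all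
qed

text \<open>The expression is divisible by 9, and 48 is not. Indeed \<open>value_kk2 k\<close> is
  divisible by 9 since k \<ge> 2; and 2 * 2^k + 4 is divisible by 3 for even k, as is the sum of the
  two values, since 2^i + 2^j is -1 + 1 modulo 3.\<close>

lemma no_solution_9:
  assumes "odd i" "even j" "j \<ge> 2" "even k" "k \<ge> 2"
  shows "\<bar>value_kk2 k * (2 * 2 ^ j) - (2 * 2 ^ k + 4) * (value_nn i + value_nn j)\<bar> \<noteq> 48"
proof -
  define i' where "i' = (if i = 1 then 1 else 2 + (i - 2) mod 6)"
  define j' where "j' = 2 + (j - 2) mod 6"
  define k' where "k' = 2 + (k - 2) mod 6"
  have p: "x ^ n mod 9 = x ^ (2 + (n - 2) mod 6) mod 9"
    if "x \<in> {2, 3, 6}" "n \<ge> 2" for x :: int and n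
    using that by (intro power_mod_periodic) auto
  have i: "x ^ i mod 9 = x ^ i' mod 9" if "x \<in> {2, 3, 6}" for x :: int
  proof (cases "i = 1")
    case False
    then have "i \<ge> 2" using assms(1) by (cases i) auto
    then show ?thesis using p[OF that, of i] False by (simp add: i'_def)
  qed (simp add: i'_def)
  have j: "x ^ j mod 9 = x ^ j' mod 9" if "x \<in> {2, 3, 6}" for x :: int
    using p[OF that, of j] assms by (auto simp: j'_def)
  have k: "x ^ k mod 9 = x ^ k' mod 9" if "x \<in> {2, 3, 6}" for x :: int
    using p[OF that, of k] assms by (auto simp: k'_def)
  have "(value_kk2 k * (2 * 2 ^ j) - (2 * 2 ^ k + 4) * (value_nn i + value_nn j)) mod 9 =
      (value_kk2 k' * (2 * 2 ^ j') - (2 * 2 ^ k' + 4) * (value_nn i' + value_nn j')) mod 9"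
    unfolding value_nn_def value_kk2_def by (intro mod_add_cong mod_diff_cong mod_mult_cong i j k refl) simp_all
  moreover have "i' \<in> set [1,3,5,7]"
  proof (cases "i = 1")
    case False
    then have "odd (i - 2)" using assms(1) by (cases i) auto
    then have "(i - 2) mod 6 \<in> set [1,3,5]"
      by (intro odd_less_6) (simp_all add: dvd_mod_iff)
    then show ?thesis unfolding i'_def using False by auto
  qed (simp add: i'_def)
  moreover have "j' \<in> set [2,4,6]"
  proof -
    have "(j - 2) mod 6 \<in> set [0,2,4]"
      using assms by (intro even_less_6) (simp_all add: dvd_mod_iff)
    then show ?thesis unfolding j'_def by auto
  qed
  moreover have "k' \<in> set [2,4,6]"
  proof -
    have "(k - 2) mod 6 \<in> set [0,2,4]"
      using assms by (intro even_less_6) (simp_all add: dvd_mod_iff)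
    then show ?thesis unfolding k'_def by auto
  qed
  ultimately show ?thesis
    using residues_9[THEN bspec, of i', THEN bspec, of j', THEN bspec, of k']
    by (intro not_in_residues[of _ 9]) simp_all
qed

text \<open>This concerns m_{i,i,1} with i even against m_p. Putting q = 0 in the formula of
  \<open>no_solution_5\<close> would count each monomial twice, hence the separate equation. The
  modulus is 9 * 5 * 7 * 13; modulo 9 the powers of 3 and 6 vanish from exponent 2 on and 2 has
  order 6.\<close>

lemma no_solution_4095:
  assumes "even i" "i \<ge> 2" "odd p" "p \<ge> 3"
  shows "\<bar>(6 ^ i + 2 * 3 ^ i + 3 * 2 ^ i) * 2 ^ p - (1 + 2 ^ p + 3 ^ p) * 2\<bar> \<noteq> (24::int)"
proof -
  define i' where "i' = 2 + (i - 2) mod 12"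
  define p' where "p' = 2 + (p - 2) mod 12"
  have per: "x ^ n mod 4095 = x ^ (2 + (n - 2) mod 12) mod 4095"
    if "x \<in> {2, 3, 6}" "n \<ge> 2" for x :: int and n
    using that by (intro power_mod_periodic) auto
  have i: "x ^ i mod 4095 = x ^ i' mod 4095" if "x \<in> {2, 3, 6}" for x :: int
    using per[OF that, of i] assms by (auto simp: i'_def)
  have p: "x ^ p mod 4095 = x ^ p' mod 4095" if "x \<in> {2, 3, 6}" for x :: int
    using per[OF that, of p] assms by (auto simp: p'_def)
  have "((6 ^ i + 2 * 3 ^ i + 3 * 2 ^ i) * 2 ^ p - (1 + 2 ^ p + 3 ^ p) * 2) mod 4095 =
      ((6 ^ i' + 2 * 3 ^ i' + 3 * 2 ^ i') * 2 ^ p' - (1 + 2 ^ p' + 3 ^ p') * 2) mod (4095::int)"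
    by (intro mod_add_cong mod_diff_cong mod_mult_cong i p refl) simp_all
  moreover have "i' \<in> set [2,4,6,8,10,12]"
  proof -
    have "(i - 2) mod 12 \<in> set [0,2,4,6,8,10]"
      using assms by (intro even_less_12) (simp_all add: dvd_mod_iff)
    then show ?thesis unfolding i'_def by auto
  qed
  moreover have "p' \<in> set [3,5,7,9,11,13]"
  proof -
    have "(p - 2) mod 12 \<in> set [1,3,5,7,9,11]"
      using assms by (intro odd_less_12) (simp_all add: dvd_mod_iff)
    then show ?thesis unfolding p'_def by auto
  qed
  ultimately show ?thesis
    using residues_4095[THEN bspec, of i', THEN bspec, of p']
    by (intro not_in_residues[of _ 4095]) simp_all
qed

text \<open>Modulo 5 the factor depending on i is 1 for every even i, and 3 = -2. If e is the even
  and o the odd one of p, q, the expression becomes 2^e + 2 * 2^o, a sum of two signs, so 0 or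
  \<plusminus>2; but 24 is -1.\<close>

lemma no_solution_5:
  assumes "even i" "odd (p + q)"
  shows "\<bar>(6 ^ i + 2 * 3 ^ i + 3 * 2 ^ i) * (2 ^ p + 2 ^ q + 2 ^ p * (-1) ^ q + 2 ^ q * (-1) ^ p)
      - (2 ^ p + 2 ^ q + 3 ^ p + 3 ^ q + 2 ^ p * 3 ^ q + 3 ^ p * 2 ^ q) * 2\<bar> \<noteq> (24::int)"
    (is "\<bar>?E i p q\<bar> \<noteq> _")
proof -
  have per: "x ^ n mod 5 = x ^ (n mod 4) mod 5" if "x \<in> {2, 3, 6, -1}" for x :: int and n
    using power_mod_periodic[of x 0 4 5 n] that by auto
  have "?E i p q mod 5 = ?E (i mod 4) (p mod 4) (q mod 4) mod 5"
    by (intro mod_add_cong mod_diff_cong mod_mult_cong per refl) simp_all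
  moreover have "i mod 4 \<in> set [0,2]" using assms(1) by simp presburger
  moreover have "p mod 4 \<in> set [0,1,2,3]" "q mod 4 \<in> set [0,1,2,3]" by auto
  moreover have "odd (p mod 4 + q mod 4)" using assms(2) by presburger
  ultimately show ?thesis
    using residues_5[THEN bspec, of "i mod 4", THEN bspec, of "p mod 4", THEN bspec, of "q mod 4"]
    by (intro not_in_residues[of _ 5]) simp_all
qed

section \<open>Growth of the values and the even determinants\<close>

lemma value_nn_less: "m < n \<Longrightarrow> value_nn m < value_nn n"
  unfolding value_nn_def by (intro add_strict_mono power_strict_increasing) auto

lemma value_nn_small: "value_nn 1 = 11" "value_nn 2 = 49" "value_nn 3 = 251"
  by (simp_all add: value_nn_def)

lemma value_nn_odd_ge: "odd i \<Longrightarrow> i \<noteq> 1 \<Longrightarrow> value_nn i \<ge> 251"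
proof -
  assume i: "odd i" "i \<noteq> 1"
  then have "i = 3 \<or> i > 3" by (cases "i = 0"; cases "i = 2") auto
  then show ?thesis using value_nn_less[of 3 i] value_nn_small by auto
qed

lemma value_nn_ge_11: "odd i \<Longrightarrow> value_nn i \<ge> 11"
  using value_nn_odd_ge[of i] value_nn_small by (cases "i = 1") auto

text \<open>In \<open>det3_unit_pos\<close> the coefficient 18 arises as 7 +
  \<open>value_nn 1\<close> for k = 0 and as 36 * 2 / 4 for k = 2. The term 6^j alone is at least 81
  * 2^j, which leaves a margin far above the 12 to be beaten.\<close>

lemma value_nn_gap: "j \<ge> 4 \<Longrightarrow> value_nn j \<ge> 18 * 2 ^ j + 1000"
proof -
  assume "j \<ge> 4"
  then have "(81::int) \<le> 3 ^ j" "(16::int) \<le> 2 ^ j"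
    using power_increasing[of 4 j "3::int"] power_increasing[of 4 j "2::int"] by simp_all
  moreover have "(6::int) ^ j = 3 ^ j * 2 ^ j" by (simp add: power_mult_distrib[symmetric])
  moreover have "(3::int) ^ j * 2 ^ j \<ge> 81 * 2 ^ j"
    using calculation(1) by (intro mult_right_mono) auto
  ultimately show ?thesis unfolding value_nn_def by linarith
qed

lemma even_ge_2_cases: "even j \<Longrightarrow> j \<noteq> 0 \<Longrightarrow> j = 2 \<or> j \<ge> (4::nat)"
  by presburger

lemma elt_kk2_values:
  fixes k :: nat
  obtains p q r where "p \<ge> q" "q \<ge> r" "even (p + q + r)" "elt_kk2 k = elt p q r"
    "mono3 p q r 1 2 3 = (if k = 0 then 14 else if k = 2 then 36 else value_kk2 k)"
    "mono3 p q r 1 2 (-1) =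
      (if k = 0 then 6 else if k = 2 then 4 else if odd k then -4 else 2 * 2 ^ k + 4)"
    "mono3 p q r 1 (-1) 0 = (if k = 0 then 2 else 0)"
proof (cases "k \<le> 2")
  case True
  then have "k = 0 \<or> k = 1 \<or> k = 2" by auto
  then show ?thesis
    using that[of k 2 k] by (auto simp: elt_kk2_def mono3_def value_kk2_def)
next
  case False
  have "(6::int) ^ k = 2 ^ k * 3 ^ k" by (simp add: power_mult_distrib[symmetric])
  then show ?thesis
    using that[of k k 2] False by (auto simp: elt_kk2_def mono3_def value_kk2_def power_0_left uminus_power_if)
qed

lemma elt_ii_values:
  assumes "odd i"
  shows "mono3 i i 0 1 2 3 = value_nn i" "mono3 i i 0 1 2 (-1) = -1" "mono3 i i 0 1 (-1) 0 = -1"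
proof -
  have "i \<noteq> 0" using assms by (cases i) auto
  moreover have "(6::int) ^ i = 2 ^ i * 3 ^ i" by (simp add: power_mult_distrib[symmetric])
  ultimately show "mono3 i i 0 1 2 3 = value_nn i" "mono3 i i 0 1 2 (-1) = -1" "mono3 i i 0 1 (-1) 0 = -1"
    using assms by (auto simp: mono3_def value_nn_def power_0_left uminus_power_if)
qed

lemma elt_jj_values:
  assumes "even j" "j \<noteq> 0"
  shows "mono3 j j 0 1 2 3 = value_nn j" "mono3 j j 0 1 2 (-1) = 2 * 2 ^ j + 1" "mono3 j j 0 1 (-1) 0 = 1"
proof -
  have "(6::int) ^ j = 2 ^ j * 3 ^ j" by (simp add: power_mult_distrib[symmetric])
  then show "mono3 j j 0 1 2 3 = value_nn j" "mono3 j j 0 1 2 (-1) = 2 * 2 ^ j + 1" "mono3 j j 0 1 (-1) 0 = 1"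
    using assms by (auto simp: mono3_def value_nn_def power_0_left uminus_power_if)
qed

lemma abs_eq_1_iff: "\<bar>d\<bar> = 1 \<longleftrightarrow> \<bar>48 * d\<bar> = (48::int)" "\<bar>d\<bar> = 1 \<longleftrightarrow> \<bar>24 * d\<bar> = (24::int)"
  by auto

text \<open>With A = \<open>value_nn i\<close> the rows of values are (A,-1,-1), (1,1,1), (a,b,c),
  and the determinant is (A + 1) (c - b), free of a. For k = 0, k = 2 and odd k one has |c - b| = 4,
  so 48 is reached only for A = 11; even k \<ge> 4 gives at least 12 * 36.\<close>

lemma det3_unit_0:
  assumes "odd i"
  shows "\<bar>det3 (elt i i 0) (elt 0 0 0) (elt_kk2 k)\<bar> = 1 \<longleftrightarrow> i = 1 \<and> (k = 0 \<or> k = 2 \<or> odd k)"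
proof -
  obtain p q r where t: "p \<ge> q" "q \<ge> r" "even (p + q + r)" "elt_kk2 k = elt p q r"
    "mono3 p q r 1 2 3 = (if k = 0 then 14 else if k = 2 then 36 else value_kk2 k)"
    "mono3 p q r 1 2 (-1) =
      (if k = 0 then 6 else if k = 2 then 4 else if odd k then -4 else 2 * 2 ^ k + 4)"
    "mono3 p q r 1 (-1) 0 = (if k = 0 then 2 else 0)"
    by (rule elt_kk2_values)
  have o: "mono3 0 0 0 x y z = 1" for x y z by (simp add: mono3_def)
  have "48 * det3 (elt i i 0) (elt 0 0 0) (elt_kk2 k) =
      (value_nn i + 1) * (mono3 p q r 1 (-1) 0 - mono3 p q r 1 2 (-1))"
    unfolding t(4) using det3_elt[of i i 0 0 0 0 q p r] t(1-3)
    by (simp add: elt_ii_values[OF assms] o algebra_simps)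
  also have "\<dots> = (if k = 0 \<or> k = 2 then - (4 * (value_nn i + 1)) else if odd k then 4 * (value_nn i + 1)
      else - ((value_nn i + 1) * (2 * 2 ^ k + 4)))"
    unfolding t(6,7) by simp
  finally have d: "48 * det3 (elt i i 0) (elt 0 0 0) (elt_kk2 k) = \<dots>" .
  have Ai: "value_nn i = 11 \<longleftrightarrow> i = 1" using value_nn_odd_ge[OF assms] value_nn_small(1) by fastforce
  show ?thesis
  proof (cases "k = 0 \<or> k = 2 \<or> odd k")
    case True
    then have "\<bar>48 * det3 (elt i i 0) (elt 0 0 0) (elt_kk2 k)\<bar> = 4 * (value_nn i + 1)"
      using value_nn_ge_11[OF assms] unfolding d by auto
    then show ?thesis unfolding abs_eq_1_iff(1) using True Ai by auto
  next
    case False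
    then have "k \<ge> 4" using even_ge_2_cases[of k] by auto
    then have "(2::int) ^ 4 \<le> 2 ^ k" by (intro power_increasing) auto
    then have "(value_nn i + 1) * (2 * 2 ^ k + 4) \<ge> 12 * 36"
      using value_nn_ge_11[OF assms] by (intro mult_mono) auto
    then show ?thesis unfolding abs_eq_1_iff(1) d using False by auto
  qed
qed

text \<open>Now a stays in the determinant. For odd k, b = -4 and c = 0 give all terms the same sign
  and D is too large; for even k \<ge> 4 divisibility by 9 excludes 48; for k = 2 growth decides;
  for k = 0 growth settles i = 1 or j = 2 and a congruence the rest.\<close>

lemma det3_unit_pos:
  assumes "odd i" "even j" "j \<noteq> 0"
  shows "\<bar>det3 (elt i i 0) (elt j j 0) (elt_kk2 k)\<bar> = 1 \<longleftrightarrow> i = 1 \<and> j = 2 \<and> (k = 0 \<or> k = 2)"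
proof -
  obtain p q r where t: "p \<ge> q" "q \<ge> r" "even (p + q + r)" "elt_kk2 k = elt p q r"
    "mono3 p q r 1 2 3 = (if k = 0 then 14 else if k = 2 then 36 else value_kk2 k)"
    "mono3 p q r 1 2 (-1) =
      (if k = 0 then 6 else if k = 2 then 4 else if odd k then -4 else 2 * 2 ^ k + 4)"
    "mono3 p q r 1 (-1) 0 = (if k = 0 then 2 else 0)"
    by (rule elt_kk2_values)
  define D where "D = 48 * det3 (elt i i 0) (elt j j 0) (elt_kk2 k)"
  have D: "D = mono3 p q r 1 2 3 * (2 * 2 ^ j) - mono3 p q r 1 2 (-1) * (value_nn i + value_nn j)
      + mono3 p q r 1 (-1) 0 * (value_nn i * (2 * 2 ^ j + 1) + value_nn j)"
    unfolding D_def t(4) using det3_elt[of i i 0 j j 0 q p r] t(1-3) assms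
    by (simp add: elt_ii_values[OF assms(1)] elt_jj_values[OF assms(2,3)] algebra_simps)
  note Ai = value_nn_odd_ge[OF assms(1)] value_nn_small(1)
  have Aj: "value_nn j \<ge> 49" using even_ge_2_cases[OF assms(2,3)] value_nn_less[of 2 j] value_nn_small(2) by auto
  have j: "j = 2 \<or> j \<ge> 4" by (rule even_ge_2_cases[OF assms(2,3)])
  consider "k = 0" | "k = 2" | "odd k" | "even k" "k \<ge> 4"
    using even_ge_2_cases[of k] by auto
  then have "\<bar>D\<bar> = 48 \<longleftrightarrow> i = 1 \<and> j = 2 \<and> (k = 0 \<or> k = 2)"
  proof cases
    case 1
    then have d: "D = - 4 * (value_nn i + value_nn j - 2 ^ j * (7 + value_nn i))"
      unfolding D t(5-7) by (simp add: algebra_simps)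
    have "\<bar>value_nn i + value_nn j - 2 ^ j * (7 + value_nn i)\<bar> = 12 \<longleftrightarrow> i = 1 \<and> j = 2"
    proof (cases "i = 1")
      case True
      then show ?thesis using j value_nn_gap[of j] value_nn_small by auto
    next
      case False
      then have "i \<ge> 3" using assms(1) by presburger
      then show ?thesis
        using j False Ai(1)[OF False] value_nn_small no_solution_7280[OF assms(1) _ assms(2)] by auto
    qed
    moreover have "\<bar>D\<bar> = 4 * \<bar>value_nn i + value_nn j - 2 ^ j * (7 + value_nn i)\<bar>"
      unfolding d by (simp only: abs_mult)
    ultimately show ?thesis using 1 by auto
  next
    case 2
    then have d: "D = 4 * (18 * 2 ^ j - (value_nn i + value_nn j))"
      unfolding D t(5-7) by simp
    have "\<bar>18 * 2 ^ j - (value_nn i + value_nn j)\<bar> = 12 \<longleftrightarrow> i = 1 \<and> j = 2"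
      using j value_nn_gap[of j] value_nn_small value_nn_ge_11[OF assms(1)] Ai(1) by (cases "i = 1") auto
    moreover have "\<bar>D\<bar> = 4 * \<bar>18 * 2 ^ j - (value_nn i + value_nn j)\<bar>"
      unfolding d by (simp only: abs_mult)
    ultimately show ?thesis using 2 by auto
  next
    case 3
    then have "k \<noteq> 0" "k \<noteq> 2" by (cases k; auto)+
    then have d: "D = value_kk2 k * (2 * 2 ^ j) + 4 * (value_nn i + value_nn j)"
      unfolding D t(5-7) using 3 by simp
    have "value_kk2 k * (2 * 2 ^ j) \<ge> 0" by (simp add: value_kk2_def)
    then have "4 * (value_nn i + value_nn j) \<le> D" unfolding d by (rule le_add_same_cancel2[THEN iffD2])
    then have "D > 48" using value_nn_ge_11[OF assms(1)] Aj by simp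
    then show ?thesis using \<open>k \<noteq> 0\<close> \<open>k \<noteq> 2\<close> by simp
  next
    case 4
    then have d: "D = value_kk2 k * (2 * 2 ^ j) - (2 * 2 ^ k + 4) * (value_nn i + value_nn j)"
      unfolding D t(5-7) by simp
    have "\<bar>D\<bar> \<noteq> 48"
      unfolding d using no_solution_9[OF assms(1,2) _ 4(1)] j 4(2) by auto
    then show ?thesis using 4 by auto
  qed
  then show ?thesis unfolding abs_eq_1_iff(1) D_def .
qed

lemma det3_unit:
  assumes "odd i" "even j"
  shows "\<bar>det3 (elt i i 0) (elt j j 0) (elt_kk2 k)\<bar> = 1 \<longleftrightarrow>
    i = 1 \<and> (j = 0 \<and> (k = 0 \<or> k = 2 \<or> odd k) \<or> j = 2 \<and> (k = 0 \<or> k = 2))"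
  using det3_unit_0[OF assms(1)] det3_unit_pos[OF assms] by (cases "j = 0") auto

section \<open>The odd determinants\<close>

lemma elt_one_values: "mono3 1 0 0 1 2 3 = 6" "mono3 1 0 0 1 2 (-1) = 2"
  by (simp_all add: mono3_def)

lemma elt_ii1_values:
  assumes "i \<ge> 2"
  shows "mono3 i i 1 1 2 3 = 6 ^ i + 2 * 3 ^ i + 3 * 2 ^ i"
    and "mono3 i i 1 1 2 (-1) = (if odd i then - (2 * 2 ^ i + 2) else 2)"
proof -
  have "(6::int) ^ i = 2 ^ i * 3 ^ i" by (simp add: power_mult_distrib[symmetric])
  then show "mono3 i i 1 1 2 3 = 6 ^ i + 2 * 3 ^ i + 3 * 2 ^ i"
    "mono3 i i 1 1 2 (-1) = (if odd i then - (2 * 2 ^ i + 2) else 2)"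
    using assms by (auto simp: mono3_def uminus_power_if)
qed

lemma elt_111_values: "mono3 1 1 1 1 2 3 = 6" "mono3 1 1 1 1 2 (-1) = -2"
  by (simp_all add: mono3_def)

lemma elt_p_values:
  assumes "odd p" "p \<ge> 2"
  shows "mono3 p 0 0 1 2 3 = 1 + 2 ^ p + 3 ^ p" "mono3 p 0 0 1 2 (-1) = 2 ^ p"
  using assms by (auto simp: mono3_def)

lemma elt_pq_values:
  assumes "p > q" "q > 0" "odd (p + q)"
  shows "mono3 p q 0 1 2 3 = 2 ^ p + 2 ^ q + 3 ^ p + 3 ^ q + 2 ^ p * 3 ^ q + 3 ^ p * 2 ^ q"
    and "mono3 p q 0 1 2 (-1) = 2 ^ p + 2 ^ q + 2 ^ p * (-1) ^ q + 2 ^ q * (-1) ^ p"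
  using assms by (auto simp: mono3_def uminus_power_if)

text \<open>Writing a, b for the two values: against m_1 the quantity 2a - 6b must exceed 24, and in
  \<open>det2_unit_ii1_pq\<close> -2a must lie below -24, whence 13. The third bound requires q > 0,
  since m_3 gives exactly 36 - 3 * 8 = 12.\<close>

lemma pq_bounds:
  assumes "p > q" "p \<ge> 2" "odd (p + q)"
  shows "mono3 p q 0 1 2 3 \<ge> 13" "mono3 p q 0 1 2 (-1) > 0"
    and "q > 0 \<Longrightarrow> mono3 p q 0 1 2 3 - 3 * mono3 p q 0 1 2 (-1) > 12"
proof -
  obtain m where m: "p = 2 + m" using assms(2) le_Suc_ex by blast
  have 23: "(2::int) ^ m \<le> 3 ^ m" by (intro power_mono) auto
  have pos: "(1::int) \<le> 2 ^ m" by simp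
  have pp: "(2::int) ^ p = 4 * 2 ^ m" "(3::int) ^ p = 9 * 3 ^ m" by (simp_all add: m power_add)
  have *: "mono3 p q 0 1 2 3 \<ge> 4 * 2 ^ p + 3 * 3 ^ p \<and> mono3 p q 0 1 2 (-1) > 0 \<and>
      mono3 p q 0 1 2 (-1) \<le> 2 * 2 ^ p" if q: "q > 0"
  proof -
    have "(2::int) \<le> 2 ^ q" "(3::int) \<le> 3 ^ q"
      using q power_increasing[of 1 q "2::int"] power_increasing[of 1 q "3::int"] by simp_all
    moreover from this have "2 ^ p * 3 \<le> 2 ^ p * (3::int) ^ q" "3 ^ p * 2 \<le> 3 ^ p * (2::int) ^ q"
      by (intro mult_left_mono; simp)+
    ultimately have "mono3 p q 0 1 2 3 \<ge> 4 * 2 ^ p + 3 * 3 ^ p"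
      unfolding elt_pq_values[OF assms(1) q assms(3)] by linarith
    moreover have "(2::int) ^ q \<le> 2 ^ p" using assms(1) by (intro power_increasing) auto
    then have "mono3 p q 0 1 2 (-1) > 0 \<and> mono3 p q 0 1 2 (-1) \<le> 2 * 2 ^ p"
      unfolding elt_pq_values[OF assms(1) q assms(3)]
      using assms(3) by (cases "even p") (auto simp: add_pos_pos)
    ultimately show ?thesis by blast
  qed
  show "mono3 p q 0 1 2 3 - 3 * mono3 p q 0 1 2 (-1) > 12" if "q > 0"
    using *[OF that] pp 23 pos by linarith
  have "mono3 p q 0 1 2 3 \<ge> 13 \<and> mono3 p q 0 1 2 (-1) > 0"
  proof (cases "q = 0")
    case True
    then have p: "odd p" using assms by simp
    show ?thesis
      unfolding True elt_p_values[OF p assms(2)] using pp 23 pos by linarith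
  next
    case False
    then show ?thesis using * pp 23 pos by linarith
  qed
  then show "mono3 p q 0 1 2 3 \<ge> 13" "mono3 p q 0 1 2 (-1) > 0" by blast+
qed

lemma det2_unit_one_ii1:
  assumes "i \<ge> 1"
  shows "\<bar>det2 (elt 1 0 0) (elt i i 1)\<bar> = 1 \<longleftrightarrow> i = 1"
proof -
  have d: "24 * det2 (elt 1 0 0) (elt i i 1) = mono3 i i 1 1 2 3 * 2 - 6 * mono3 i i 1 1 2 (-1)"
    using det2_elt[of 0 1 0 i i 1] assms elt_one_values by simp
  show ?thesis
  proof (cases "i = 1")
    case True
    then show ?thesis unfolding abs_eq_1_iff(2) d using elt_111_values by simp
  next
    case False
    then have i: "i \<ge> 2" using assms by simp
    then have "(6::int) ^ 2 \<le> 6 ^ i" "(3::int) ^ 2 \<le> 3 ^ i" "(2::int) ^ 2 \<le> 2 ^ i"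
      by (intro power_increasing; simp)+
    then show ?thesis unfolding abs_eq_1_iff(2) d elt_ii1_values[OF i] using False by auto
  qed
qed

lemma det2_unit_one_pq:
  assumes "p > q" "p \<ge> 2" "odd (p + q)"
  shows "\<bar>det2 (elt 1 0 0) (elt p q 0)\<bar> = 1 \<longleftrightarrow> p = 3 \<and> q = 0"
proof -
  have d: "24 * det2 (elt 1 0 0) (elt p q 0) = mono3 p q 0 1 2 3 * 2 - 6 * mono3 p q 0 1 2 (-1)"
    using det2_elt[of 0 1 0 q p 0] assms elt_one_values by simp
  show ?thesis
  proof (cases "q = 0")
    case False
    then show ?thesis unfolding abs_eq_1_iff(2) d using pq_bounds[OF assms] by auto
  next
    case True
    then have p: "odd p" using assms by simp
    have "p = 3 \<or> p \<ge> 5" using assms(2) p by presburger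
    then show ?thesis
    proof
      assume "p = 3"
      then show ?thesis unfolding abs_eq_1_iff(2) d using True elt_p_values[of 3] by simp
    next
      assume "p \<ge> 5"
      \<comment> \<open>With 32 = 2^5 and 243 = 3^5 only a linear inequality in 2^m \<le> 3^m is
        left; at p = 3 the quantity is exactly 24.\<close>
      then obtain m where m: "p = 5 + m" using le_Suc_ex by blast
      have gap: "24 < (1 + 32 * x + 243 * y) * 2 - 6 * (32 * x)" if "x \<le> y" "1 \<le> x" for x y :: int
        using that by simp
      have "(2::int) ^ m \<le> 3 ^ m" by (intro power_mono) auto
      moreover have "(1::int) \<le> 2 ^ m" by simp
      moreover have "(2::int) ^ p = 32 * 2 ^ m" "(3::int) ^ p = 243 * 3 ^ m" by (simp_all add: m power_add)
      ultimately have "24 * det2 (elt 1 0 0) (elt p q 0) > 24"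
        unfolding d unfolding True elt_p_values[OF p assms(2)] using gap by metis
      then show ?thesis using \<open>p \<ge> 5\<close> by linarith
    qed
  qed
qed

text \<open>For odd i the value of m_{i,i,1} at (1,2,-1) is negative, both products pull in the same
  direction and size decides. For even i it is 2, two growing terms are subtracted, and the
  congruences are needed.\<close>

lemma det2_unit_ii1_pq:
  assumes "i \<ge> 1" "p > q" "p \<ge> 2" "odd (p + q)"
  shows "\<bar>det2 (elt i i 1) (elt p q 0)\<bar> \<noteq> 1"
proof -
  let ?a = "mono3 p q 0 1 2 3" and ?b = "mono3 p q 0 1 2 (-1)"
  have d: "24 * det2 (elt i i 1) (elt p q 0) = ?a * mono3 i i 1 1 2 (-1) - mono3 i i 1 1 2 3 * ?b"
    using det2_elt[of i i 1 q p 0] assms by simp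
  note ab = pq_bounds(1,2)[OF assms(2-4)]
  have neg: ?thesis if "mono3 i i 1 1 2 (-1) \<le> -2" "mono3 i i 1 1 2 3 \<ge> 0"
  proof -
    have "?a * mono3 i i 1 1 2 (-1) \<le> ?a * (-2)" using that ab by (intro mult_left_mono) auto
    moreover have "mono3 i i 1 1 2 3 * ?b \<ge> 0" using that ab by simp
    ultimately have "24 * det2 (elt i i 1) (elt p q 0) < -24" using d ab by linarith
    then show ?thesis by linarith
  qed
  show ?thesis
  proof (cases "i = 1")
    case True
    then show ?thesis using neg elt_111_values by simp
  next
    case False
    then have i: "i \<ge> 2" using assms by simp
    show ?thesis
    proof (cases "odd i")
      case True
      then show ?thesis using neg elt_ii1_values[OF i] by simp
    next
      case False
      then have d': "24 * det2 (elt i i 1) (elt p q 0) = - ((6 ^ i + 2 * 3 ^ i + 3 * 2 ^ i) * ?b - ?a * 2)"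
        unfolding d elt_ii1_values[OF i] by simp
      show ?thesis
      proof (cases "q = 0")
        case True
        then have "odd p" "p \<ge> 3" using assms by (auto, presburger)
        then show ?thesis
          unfolding abs_eq_1_iff(2) d' abs_minus_cancel
          using no_solution_4095[of i p] False i True elt_p_values[of p] by simp
      next
        case q: False
        then show ?thesis
          unfolding abs_eq_1_iff(2) d' abs_minus_cancel
          using no_solution_5[of i p q] False assms(4) elt_pq_values[OF assms(2) _ assms(4)] by simp
      qed
    qed
  qed
qed

section \<open>Classification of the bases\<close>

lemma parity_vec_cong:
  assumes "parity_vec b = parity_vec b'" "t < 5"
  shows "odd (b (rep t)) = odd (b' (rep t))"
  using assms unfolding less_5 parity_vec_def by auto

lemma even_sum_parity:
  assumes "parity_vec b = parity_vec b'"
  shows "even (\<Sum>t<5. d t * b (rep t)) = even (\<Sum>t<5. d t * b' (rep t) :: int)"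
proof -
  have "even (\<Sum>t<5. d t * b (rep t) - d t * b' (rep t))"
    using parity_vec_cong[OF assms] by (intro dvd_sum) (auto simp: right_diff_distrib[symmetric])
  then show ?thesis by (simp add: sum_subtractf)
qed

lemma basis_parity_nonzero:
  assumes "is_Z_basis_of_centre B" "b \<in> B"
  shows "parity_vec b \<noteq> [False, False, False, False, False]"
proof
  assume "parity_vec b = [False, False, False, False, False]"
  then have "parity_vec b = parity_vec (\<lambda>_. 0)" by (simp add: parity_vec_def)
  moreover obtain d where "(\<Sum>t<5. d t * b (rep t)) = (1::int)"
    using basis_dual_functional[OF assms] assms(2) by auto
  ultimately show False using even_sum_parity[of b "\<lambda>_. 0" d] by simp
qed

text \<open>The coefficient functional of b is 1 on b and 0 on every other element, yet an integral
  functional has equal parity on elements with equal parity vectors.\<close>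

lemma basis_parity_inj:
  assumes "is_Z_basis_of_centre B" "b \<in> B" "b' \<in> B" "parity_vec b = parity_vec b'"
  shows "b = b'"
proof (rule ccontr)
  assume "b \<noteq> b'"
  obtain d :: "nat \<Rightarrow> int" where d: "\<forall>c\<in>B. (\<Sum>t<5. d t * c (rep t)) = (if c = b then 1 else 0)"
    using basis_dual_functional[OF assms(1,2)] by blast
  have "(\<Sum>t<5. d t * b (rep t)) = 1" "(\<Sum>t<5. d t * b' (rep t)) = 0"
    using bspec[OF d assms(2)] bspec[OF d assms(3)] \<open>b \<noteq> b'\<close> by simp_all
  then show False using even_sum_parity[OF assms(4), of d] by simp
qed

text \<open>The sum of the coordinates in T is a nonzero functional modulo 2, so it cannot vanish on
  a generating set. Suitable T detect single parity patterns.\<close>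

lemma basis_parity_spanning:
  assumes "is_Z_basis_of_centre B" "T \<subseteq> {..<5}" "T \<noteq> {}"
  shows "\<exists>b\<in>B. odd (\<Sum>t\<in>T. b (rep t))"
proof (rule ccontr)
  assume *: "\<not> (\<exists>b\<in>B. odd (\<Sum>t\<in>T. b (rep t)))"
  define d :: "nat \<Rightarrow> int" where "d t = (if t \<in> T then 1 else 0)" for t
  have "(\<Sum>t<5. d t * b (rep t)) = (\<Sum>t\<in>T. b (rep t))" for b :: "(nat \<Rightarrow> nat) \<Rightarrow> int"
  proof -
    have "(\<Sum>t<5. d t * b (rep t)) = (\<Sum>t<5. if t \<in> T then b (rep t) else 0)"
      by (intro sum.cong) (auto simp: d_def)
    also have "\<dots> = (\<Sum>t\<in>T. b (rep t))"
      using assms(2) by (simp add: sum.inter_restrict[symmetric] Int_absorb1)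
    finally show ?thesis .
  qed
  then have "\<forall>b\<in>B. even (\<Sum>t<5. d t * b (rep t))" using * by simp
  then have "even (d s)" if "s \<in> T" for s
    using basis_even_functional[OF assms(1)] assms(2) that by blast
  then show False using assms(3) by (auto simp: d_def)
qed

text \<open>The matrix of the three coefficient functionals, with determinant D, is inverse to the
  coordinate matrix of u, v, w, whose remaining coordinates are zero. Hence the product of the
  determinants is 1.\<close>

lemma det3_unit_of_basis:
  assumes B: "is_Z_basis_of_centre B" and uvw: "u \<in> B" "v \<in> B" "w \<in> B" "distinct [u, v, w]"
    and e: "even_supported u" "even_supported v" "even_supported w"
  shows "\<bar>det3 u v w\<bar> = 1"
proof -
  obtain d1 :: "nat \<Rightarrow> int" where d1: "\<forall>c\<in>B. (\<Sum>t<5. d1 t * c (rep t)) = (if c = u then 1 else 0)"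
    using basis_dual_functional[OF B uvw(1)] by blast
  obtain d2 :: "nat \<Rightarrow> int" where d2: "\<forall>c\<in>B. (\<Sum>t<5. d2 t * c (rep t)) = (if c = v then 1 else 0)"
    using basis_dual_functional[OF B uvw(2)] by blast
  obtain d3 :: "nat \<Rightarrow> int" where d3: "\<forall>c\<in>B. (\<Sum>t<5. d3 t * c (rep t)) = (if c = w then 1 else 0)"
    using basis_dual_functional[OF B uvw(3)] by blast
  define f where "f d c = d 0 * c (rep 0) + d 1 * c (rep 1) + d 2 * c (rep 2)"
    for d :: "nat \<Rightarrow> int" and c :: "(nat \<Rightarrow> nat) \<Rightarrow> int"
  define D where "D = d1 0 * (d2 1 * d3 2 - d2 2 * d3 1) - d1 1 * (d2 0 * d3 2 - d2 2 * d3 0)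
    + d1 2 * (d2 0 * d3 1 - d2 1 * d3 0)"
  have s: "(\<Sum>t<5. d t * c (rep t)) = f d c" if "even_supported c" for d c
    using that by (simp add: sum_less_5 f_def even_supported_def)
  have "D * det3 u v w = f d1 u * (f d2 v * f d3 w - f d2 w * f d3 v)
    - f d1 v * (f d2 u * f d3 w - f d2 w * f d3 u) + f d1 w * (f d2 u * f d3 v - f d2 v * f d3 u)"
    unfolding D_def det3_def f_def by (simp add: algebra_simps)
  also have "\<dots> = 1"
    using bspec[OF d1 uvw(1)] bspec[OF d1 uvw(2)] bspec[OF d1 uvw(3)]
      bspec[OF d2 uvw(1)] bspec[OF d2 uvw(2)] bspec[OF d2 uvw(3)]
      bspec[OF d3 uvw(1)] bspec[OF d3 uvw(2)] bspec[OF d3 uvw(3)] uvw(4)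
    by (simp add: s e)
  finally have "det3 u v w dvd 1" by (metis dvd_triv_right)
  then show ?thesis by (simp only: zdvd1_eq)
qed

lemma det2_unit_of_basis:
  assumes B: "is_Z_basis_of_centre B" and xy: "x \<in> B" "y \<in> B" "x \<noteq> y"
    and o: "odd_supported x" "odd_supported y"
  shows "\<bar>det2 x y\<bar> = 1"
proof -
  obtain d1 :: "nat \<Rightarrow> int" where d1: "\<forall>c\<in>B. (\<Sum>t<5. d1 t * c (rep t)) = (if c = x then 1 else 0)"
    using basis_dual_functional[OF B xy(1)] by blast
  obtain d2 :: "nat \<Rightarrow> int" where d2: "\<forall>c\<in>B. (\<Sum>t<5. d2 t * c (rep t)) = (if c = y then 1 else 0)"
    using basis_dual_functional[OF B xy(2)] by blast
  define f where "f d c = d 3 * c (rep 3) + d 4 * c (rep 4)"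
    for d :: "nat \<Rightarrow> int" and c :: "(nat \<Rightarrow> nat) \<Rightarrow> int"
  have s: "(\<Sum>t<5. d t * c (rep t)) = f d c" if "odd_supported c" for d c
    using that by (simp add: sum_less_5 f_def odd_supported_def)
  have "(d1 3 * d2 4 - d1 4 * d2 3) * det2 x y = f d1 x * f d2 y - f d1 y * f d2 x"
    unfolding det2_def f_def by (simp add: algebra_simps)
  also have "\<dots> = 1"
    using bspec[OF d1 xy(1)] bspec[OF d1 xy(2)] bspec[OF d2 xy(1)] bspec[OF d2 xy(2)] xy(3)
    by (simp add: s o)
  finally have "det2 x y dvd 1" by (metis dvd_triv_right)
  then show ?thesis by (simp only: zdvd1_eq)
qed

definition msym_kind :: "bool list \<Rightarrow> ((nat \<Rightarrow> nat) \<Rightarrow> int) \<Rightarrow> bool" where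
  "msym_kind v b \<longleftrightarrow>
    v = [False, True, True, False, False] \<and> (\<exists>i. odd i \<and> b = elt i i 0) \<or>
    v = [True, False, False, False, False] \<and> (\<exists>j. even j \<and> b = elt j j 0) \<or>
    v = [False, False, True, False, False] \<and> (\<exists>k. b = elt_kk2 k) \<or>
    v = [False, False, False, True, False] \<and> b = elt 1 0 0 \<or>
    v = [False, False, False, False, True] \<and> (\<exists>i\<ge>1. b = elt i i 1) \<or>
    v = [False, False, False, True, True] \<and> (\<exists>p q. p > q \<and> p \<ge> 2 \<and> odd (p + q) \<and> b = elt p q 0)"

lemma msym_kind_simps:
  "msym_kind [False, True, True, False, False] b \<longleftrightarrow> (\<exists>i. odd i \<and> b = elt i i 0)"
  "msym_kind [True, False, False, False, False] b \<longleftrightarrow> (\<exists>j. even j \<and> b = elt j j 0)"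
  "msym_kind [False, False, True, False, False] b \<longleftrightarrow> (\<exists>k. b = elt_kk2 k)"
  "msym_kind [False, False, False, True, False] b \<longleftrightarrow> b = elt 1 0 0"
  "msym_kind [False, False, False, False, True] b \<longleftrightarrow> (\<exists>i\<ge>1. b = elt i i 1)"
  "msym_kind [False, False, False, True, True] b \<longleftrightarrow>
    (\<exists>p q. p > q \<and> p \<ge> 2 \<and> odd (p + q) \<and> b = elt p q 0)"
  by (simp_all add: msym_kind_def)

lemma msym_kind_parity_vec:
  assumes "is_partition \<mu>" "b = msym \<mu>" "parity_vec b \<noteq> [False, False, False, False, False]"
  shows "msym_kind (parity_vec b) b"
  using assms(1)
proof (cases rule: msym_cases)
  case 1
  then show ?thesis using assms by (simp add: parity_vec_def)
next
  case (2 p q r)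
  then have b: "b = elt p q r" using assms(2) by simp
  from 2(1,2) show ?thesis
  proof (cases rule: elt_cases)
    case null
    then show ?thesis using assms(3) b by simp
  next
    case (ii i)
    then show ?thesis unfolding b ii(3) msym_kind_simps by (intro exI[of _ i] conjI)
  next
    case (jj j)
    then show ?thesis unfolding b jj(3) msym_kind_simps by (intro exI[of _ j] conjI)
  next
    case (kk2 k)
    then show ?thesis unfolding b kk2(2) msym_kind_simps by (intro exI[of _ k])
  next
    case one
    then show ?thesis unfolding b one(2) msym_kind_simps by simp
  next
    case (ii1 i)
    then show ?thesis unfolding b ii1(3) msym_kind_simps by (intro exI[of _ i] conjI)
  next
    case (pq x y)
    then show ?thesis unfolding b pq(5) msym_kind_simps by (intro exI[of _ x] exI[of _ y] conjI)
  qed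
qed

text \<open>The three patterns add up to zero modulo 2, while the coefficient functional of x takes
  the value 1 on x + y + z.\<close>

lemma basis_not_three_odd_kinds:
  assumes B: "is_Z_basis_of_centre B" and "x \<in> B" "y \<in> B" "z \<in> B"
    and v: "parity_vec x = [False, False, False, True, False]"
      "parity_vec y = [False, False, False, False, True]"
      "parity_vec z = [False, False, False, True, True]"
  shows False
proof -
  have "x \<noteq> y" "x \<noteq> z" using v by auto
  obtain d :: "nat \<Rightarrow> int" where d: "\<forall>c\<in>B. (\<Sum>t<5. d t * c (rep t)) = (if c = x then 1 else 0)"
    using basis_dual_functional[OF B assms(2)] by blast
  have "parity_vec (\<lambda>g. x g + y g + z g) = parity_vec (\<lambda>_. 0)"
    using v by (simp add: parity_vec_def)
  from even_sum_parity[OF this, of d] have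
    "even ((\<Sum>t<5. d t * x (rep t)) + (\<Sum>t<5. d t * y (rep t)) + (\<Sum>t<5. d t * z (rep t)))"
    by (simp add: distrib_left sum.distrib)
  then show False
    using bspec[OF d assms(2)] bspec[OF d assms(3)] bspec[OF d assms(4)] \<open>x \<noteq> y\<close> \<open>x \<noteq> z\<close> by simp
qed

lemma elt_kk2_even_supported: "even_supported (elt_kk2 k)"
  by (rule elt_kk2_values[of k]) (simp add: elt_even_coordinates(1))

lemma basis_kinds:
  assumes B: "is_Z_basis_of_centre B" and sub: "B \<subseteq> {msym \<mu> | \<mu>. is_partition \<mu>}"
  obtains i j k x y where "odd i" "even j" "B = {elt i i 0, elt j j 0, elt_kk2 k, x, y}"
    "\<bar>det3 (elt i i 0) (elt j j 0) (elt_kk2 k)\<bar> = 1" "x = elt 1 0 0" "y = elt 1 1 1 \<or> y = elt 3 0 0"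
proof -
  let ?v1 = "[False, True, True, False, False]" and ?v2 = "[True, False, False, False, False]"
    and ?v3 = "[False, False, True, False, False]" and ?v4 = "[False, False, False, True, False]"
    and ?v5 = "[False, False, False, False, True]" and ?v6 = "[False, False, False, True, True]"
  have kind: "msym_kind (parity_vec b) b" if "b \<in> B" for b
  proof -
    obtain \<mu> where "is_partition \<mu>" "b = msym \<mu>" using sub \<open>b \<in> B\<close> by auto
    then show ?thesis using msym_kind_parity_vec basis_parity_nonzero[OF B \<open>b \<in> B\<close>] by metis
  qed
  have vals: "parity_vec b = ?v1 \<or> parity_vec b = ?v2 \<or> parity_vec b = ?v3 \<or> parity_vec b = ?v4 \<or>
      parity_vec b = ?v5 \<or> parity_vec b = ?v6" if "b \<in> B" for b
    using kind[OF that] unfolding msym_kind_def by (elim disjE conjE) simp_all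
  have v: "odd (b (rep 0)) = parity_vec b ! 0" "odd (b (rep 1)) = parity_vec b ! 1"
    "odd (b (rep 2)) = parity_vec b ! 2" "odd (b (rep 3)) = parity_vec b ! 3"
    "odd (b (rep 4)) = parity_vec b ! 4" for b
    by (simp_all add: parity_vec_def)
  obtain u where u: "u \<in> B" "parity_vec u = ?v1"
  proof -
    obtain b where b: "b \<in> B" "odd (b (rep 1))"
      using basis_parity_spanning[OF B, of "{1}"] by auto
    show thesis using that[OF b(1)] vals[OF b(1)] b(2) unfolding v by (elim disjE) simp_all
  qed
  obtain v' where v': "v' \<in> B" "parity_vec v' = ?v2"
  proof -
    obtain b where b: "b \<in> B" "odd (b (rep 0))"
      using basis_parity_spanning[OF B, of "{0}"] by auto
    show thesis using that[OF b(1)] vals[OF b(1)] b(2) unfolding v by (elim disjE) simp_all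
  qed
  \<comment> \<open>Coordinates 1 and 0 are odd in one pattern each, which gave u and v'. The sum of
    coordinates 1 and 2 is even on the pattern of u and odd only on the third.\<close>
  obtain w where w: "w \<in> B" "parity_vec w = ?v3"
  proof -
    obtain b where b: "b \<in> B" "odd (b (rep 1)) \<noteq> odd (b (rep 2))"
      using basis_parity_spanning[OF B, of "{1, 2}"] by auto
    show thesis using that[OF b(1)] vals[OF b(1)] b(2) unfolding v by (elim disjE) simp_all
  qed
  \<comment> \<open>Each of coordinate 3, coordinate 4 and their sum is even on one of the three odd
    patterns, so no single pattern serves all three and at least two occur.\<close>
  have odd_pair: "\<exists>x\<in>B. \<exists>y\<in>B. (parity_vec x, parity_vec y) \<in> {(?v4, ?v5), (?v4, ?v6), (?v5, ?v6)}"
  proof -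
    obtain b where b: "b \<in> B" "odd (b (rep 3))"
      using basis_parity_spanning[OF B, of "{3}"] by auto
    have b': "parity_vec b = ?v4 \<or> parity_vec b = ?v6"
      using vals[OF b(1)] b(2) unfolding v by (elim disjE) simp_all
    obtain c where c: "c \<in> B" "odd (c (rep 4))"
      using basis_parity_spanning[OF B, of "{4}"] by auto
    have c': "parity_vec c = ?v5 \<or> parity_vec c = ?v6"
      using vals[OF c(1)] c(2) unfolding v by (elim disjE) simp_all
    obtain e where e: "e \<in> B" "odd (e (rep 3)) \<noteq> odd (e (rep 4))"
      using basis_parity_spanning[OF B, of "{3, 4}"] by auto
    have e': "parity_vec e = ?v4 \<or> parity_vec e = ?v5"
      using vals[OF e(1)] e(2) unfolding v by (elim disjE) simp_all
    show ?thesis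
      using b' c' e' b(1) c(1) e(1) by (elim disjE) (simp_all, metis+)
  qed
  then obtain x y where xy: "x \<in> B" "y \<in> B"
    "(parity_vec x, parity_vec y) \<in> {(?v4, ?v5), (?v4, ?v6), (?v5, ?v6)}" by blast
  \<comment> \<open>A sixth pattern would bring all three odd kinds together; so b shares its parity
    vector with one of the five and equals it.\<close>
  have "b \<in> {u, v', w, x, y}" if "b \<in> B" for b
  proof -
    have "parity_vec b \<in> {parity_vec u, parity_vec v', parity_vec w, parity_vec x, parity_vec y}"
      using vals[OF that] xy(3) basis_not_three_odd_kinds[OF B]
      unfolding u(2) v'(2) w(2) using xy(1,2) that by (elim disjE insertE emptyE) auto
    then show ?thesis
      using basis_parity_inj[OF B that] u(1) v'(1) w(1) xy(1,2) by auto
  qed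
  then have Beq: "B = {u, v', w, x, y}"
    using u(1) v'(1) w(1) xy(1,2) by auto
  obtain i where i: "odd i" "u = elt i i 0"
    using kind[OF u(1)] unfolding u(2) msym_kind_simps by blast
  obtain j where j: "even j" "v' = elt j j 0"
    using kind[OF v'(1)] unfolding v'(2) msym_kind_simps by blast
  obtain k where k: "w = elt_kk2 k"
    using kind[OF w(1)] unfolding w(2) msym_kind_simps by blast
  have "distinct [u, v', w]" using u(2) v'(2) w(2) by auto
  then have d3: "\<bar>det3 u v' w\<bar> = 1"
    using i j k u(1) v'(1) w(1)
    by (intro det3_unit_of_basis[OF B]) (simp_all add: elt_kk2_even_supported elt_even_coordinates(1))
  have "x \<noteq> y" using xy(3) by auto
  have one: "odd_supported (elt 1 0 0)" by (simp add: elt_odd_coordinates(1))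
  from xy(3) have "x = elt 1 0 0 \<and> (y = elt 1 1 1 \<or> y = elt 3 0 0)"
  proof (elim insertE emptyE)
    assume "(parity_vec x, parity_vec y) = (?v4, ?v5)"
    then have p: "parity_vec x = ?v4" "parity_vec y = ?v5" by simp_all
    have x: "x = elt 1 0 0" using kind[OF xy(1)] unfolding p msym_kind_simps .
    obtain m where m: "m \<ge> 1" "y = elt m m 1"
      using kind[OF xy(2)] unfolding p msym_kind_simps by blast
    have "\<bar>det2 x y\<bar> = 1"
      using m x one by (intro det2_unit_of_basis[OF B xy(1,2) \<open>x \<noteq> y\<close>]) (simp_all add: elt_odd_coordinates(1))
    then show ?thesis using det2_unit_one_ii1[OF m(1)] m x by simp
  next
    assume "(parity_vec x, parity_vec y) = (?v4, ?v6)"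
    then have p: "parity_vec x = ?v4" "parity_vec y = ?v6" by simp_all
    have x: "x = elt 1 0 0" using kind[OF xy(1)] unfolding p msym_kind_simps .
    obtain a b where ab: "a > b" "a \<ge> 2" "odd (a + b)" "y = elt a b 0"
      using kind[OF xy(2)] unfolding p msym_kind_simps by blast
    have "\<bar>det2 x y\<bar> = 1"
      using ab x one by (intro det2_unit_of_basis[OF B xy(1,2) \<open>x \<noteq> y\<close>]) (simp_all add: elt_odd_coordinates(1))
    then show ?thesis using det2_unit_one_pq[OF ab(1-3)] ab x by simp
  next
    assume "(parity_vec x, parity_vec y) = (?v5, ?v6)"
    then have p: "parity_vec x = ?v5" "parity_vec y = ?v6" by simp_all
    obtain m where m: "m \<ge> 1" "x = elt m m 1"
      using kind[OF xy(1)] unfolding p msym_kind_simps by blast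
    obtain a b where ab: "a > b" "a \<ge> 2" "odd (a + b)" "y = elt a b 0"
      using kind[OF xy(2)] unfolding p msym_kind_simps by blast
    have "\<bar>det2 x y\<bar> = 1"
      using ab m by (intro det2_unit_of_basis[OF B xy(1,2) \<open>x \<noteq> y\<close>]) (simp_all add: elt_odd_coordinates(1))
    then show ?thesis using det2_unit_ii1_pq[OF m(1) ab(1-3)] m ab by simp
  qed
  then show thesis
    using that[OF i(1) j(1) Beq[unfolded i(2) j(2) k] d3[unfolded i(2) j(2) k]] by (simp only: simp_thms)
qed

lemma basis_iff:
  assumes "B \<subseteq> {msym \<mu> | \<mu>. is_partition \<mu>}"
  shows "is_Z_basis_of_centre B \<longleftrightarrow>
    (\<exists>j k y. (j = 0 \<and> (k = 0 \<or> k = 2 \<or> odd k) \<or> j = 2 \<and> (k = 0 \<or> k = 2)) \<and>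
      (y = elt 1 1 1 \<or> y = elt 3 0 0) \<and> B = {elt 1 1 0, elt j j 0, elt_kk2 k, elt 1 0 0, y})"
    (is "?L \<longleftrightarrow> ?R")
proof
  assume ?L
  then show ?R
  proof (rule basis_kinds[OF _ assms])
    fix i j k x y
    assume h: "odd i" "even j" "B = {elt i i 0, elt j j 0, elt_kk2 k, x, y}"
      "\<bar>det3 (elt i i 0) (elt j j 0) (elt_kk2 k)\<bar> = 1" "x = elt 1 0 0" "y = elt 1 1 1 \<or> y = elt 3 0 0"
    from h(4) have "i = 1" "j = 0 \<and> (k = 0 \<or> k = 2 \<or> odd k) \<or> j = 2 \<and> (k = 0 \<or> k = 2)"
      unfolding det3_unit[OF h(1,2)] by simp_all
    then show ?R using h(3,5,6) by (intro exI[of _ j] exI[of _ k] exI[of _ y]) simp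
  qed
next
  assume ?R
  then obtain j k y where h: "j = 0 \<and> (k = 0 \<or> k = 2 \<or> odd k) \<or> j = 2 \<and> (k = 0 \<or> k = 2)"
      "y = elt 1 1 1 \<or> y = elt 3 0 0" "B = {elt 1 1 0, elt j j 0, elt_kk2 k, elt 1 0 0, y}"
    by blast
  have j: "even j" using h(1) by auto
  show ?L
    unfolding h(3)
  proof (rule basis_of_dets)
    show "\<bar>det3 (elt 1 1 0) (elt j j 0) (elt_kk2 k)\<bar> = 1"
      using det3_unit[of 1 j k] j h(1) by simp
    show "\<bar>det2 (elt 1 0 0) y\<bar> = 1"
      using h(2) det2_unit_one_ii1[of 1] det2_unit_one_pq[of 0 3] by auto
    show "odd_supported y" using h(2) by (auto simp: elt_odd_coordinates(1))
  qed (simp_all add: j elt_kk2_even_supported elt_even_coordinates(1) elt_odd_coordinates(1))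
qed

section \<open>Matching with the explicit list\<close>

lemma elt_kk2_odd: "odd k \<Longrightarrow> elt_kk2 k = msym (rev (sort [k, k, 2]))"
proof -
  assume k: "odd k"
  then have "k = 1 \<or> k > 2" by (cases "k = 0"; cases "k = 2") auto
  then show ?thesis by (auto simp: elt_kk2_def elt_def)
qed

lemma elt_small:
  "elt 1 1 0 = msym [1,1]" "elt 0 0 0 = msym []" "elt 2 2 0 = msym [2,2]" "elt 1 0 0 = msym [1]"
  "elt 1 1 1 = msym [1,1,1]" "elt 3 0 0 = msym [3]" "elt_kk2 0 = msym [2]" "elt_kk2 2 = msym [2,2,2]"
  by (simp_all add: elt_def elt_kk2_def)

lemma basis_family_enumeration:
  fixes S :: "nat \<Rightarrow> nat \<Rightarrow> 'y \<Rightarrow> 's"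
  shows "(\<exists>j k y. (j = 0 \<and> (k = 0 \<or> k = 2 \<or> odd k) \<or> j = 2 \<and> (k = 0 \<or> k = 2)) \<and>
      (y = y1 \<or> y = y2) \<and> B = S j k y) \<longleftrightarrow>
    B = S 0 0 y1 \<or> B = S 0 2 y1 \<or> B = S 2 0 y1 \<or> B = S 2 2 y1 \<or>
    B = S 0 0 y2 \<or> B = S 0 2 y2 \<or> B = S 2 0 y2 \<or> B = S 2 2 y2 \<or>
    (\<exists>i. odd i \<and> i \<ge> 1 \<and> B = S 0 i y1) \<or> (\<exists>i. odd i \<and> i \<ge> 1 \<and> B = S 0 i y2)"
proof -
  have "odd i \<longleftrightarrow> odd i \<and> i \<ge> 1" for i :: nat
    by (cases i) auto
  then show ?thesis by blast
qed

theorem theorem3p5: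
  assumes "B \<subseteq> {msym \<mu> | \<mu>. is_partition \<mu>}"
  shows "is_Z_basis_of_centre B \<longleftrightarrow>
    B = {msym [], msym [1], msym [2], msym [1,1], msym [1,1,1]} \<or>
    B = {msym [], msym [1], msym [1,1], msym [1,1,1], msym [2,2,2]} \<or>
    B = {msym [1], msym [2], msym [1,1], msym [1,1,1], msym [2,2]} \<or>
    B = {msym [1], msym [1,1], msym [1,1,1], msym [2,2], msym [2,2,2]} \<or>
    B = {msym [], msym [1], msym [2], msym [1,1], msym [3]} \<or>
    B = {msym [], msym [1], msym [1,1], msym [2,2,2], msym [3]} \<or>
    B = {msym [1], msym [2], msym [1,1], msym [3], msym [2,2]} \<or>
    B = {msym [1], msym [1,1], msym [3], msym [2,2], msym [2,2,2]} \<or>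
    (\<exists>i::nat. odd i \<and> i \<ge> 1 \<and>
       B = {msym [], msym [1], msym [1,1], msym [1,1,1], msym (rev (sort [i,i,2]))}) \<or>
    (\<exists>i::nat. odd i \<and> i \<ge> 1 \<and>
       B = {msym [], msym [1], msym [1,1], msym [3], msym (rev (sort [i,i,2]))})"
proof -
  let ?S = "\<lambda>j k y. {elt 1 1 0, elt j j 0, elt_kk2 k, elt 1 0 0, y}"
  have sets:
    "?S 0 0 (elt 1 1 1) = {msym [], msym [1], msym [2], msym [1,1], msym [1,1,1]}"
    "?S 0 2 (elt 1 1 1) = {msym [], msym [1], msym [1,1], msym [1,1,1], msym [2,2,2]}"
    "?S 2 0 (elt 1 1 1) = {msym [1], msym [2], msym [1,1], msym [1,1,1], msym [2,2]}"
    "?S 2 2 (elt 1 1 1) = {msym [1], msym [1,1], msym [1,1,1], msym [2,2], msym [2,2,2]}"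
    "?S 0 0 (elt 3 0 0) = {msym [], msym [1], msym [2], msym [1,1], msym [3]}"
    "?S 0 2 (elt 3 0 0) = {msym [], msym [1], msym [1,1], msym [2,2,2], msym [3]}"
    "?S 2 0 (elt 3 0 0) = {msym [1], msym [2], msym [1,1], msym [3], msym [2,2]}"
    "?S 2 2 (elt 3 0 0) = {msym [1], msym [1,1], msym [3], msym [2,2], msym [2,2,2]}"
    unfolding elt_small by (simp_all only: insert_commute)
  have odd_sets:
    "?S 0 i (elt 1 1 1) = {msym [], msym [1], msym [1,1], msym [1,1,1], msym (rev (sort [i,i,2]))}"
    "?S 0 i (elt 3 0 0) = {msym [], msym [1], msym [1,1], msym [3], msym (rev (sort [i,i,2]))}"
    if "odd i" for i
    unfolding elt_small elt_kk2_odd[OF that] by (simp_all only: insert_commute)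
  have families:
    "(\<exists>i. odd i \<and> i \<ge> 1 \<and> B = ?S 0 i (elt 1 1 1)) \<longleftrightarrow> (\<exists>i. odd i \<and> i \<ge> 1 \<and>
      B = {msym [], msym [1], msym [1,1], msym [1,1,1], msym (rev (sort [i,i,2]))})"
    "(\<exists>i. odd i \<and> i \<ge> 1 \<and> B = ?S 0 i (elt 3 0 0)) \<longleftrightarrow> (\<exists>i. odd i \<and> i \<ge> 1 \<and>
      B = {msym [], msym [1], msym [1,1], msym [3], msym (rev (sort [i,i,2]))})"
    using odd_sets by metis+
  show ?thesis
    unfolding basis_iff[OF assms] basis_family_enumeration[of "elt 1 1 1" "elt 3 0 0" B ?S] sets families
    by (rule refl)
qed

end
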